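(* Let $B=B_{\tilde\theta}$ be the subalgebra of $U$ generated by $\mathcal M$, $T_\Theta$, and the elements $B_i=y_it_i+\tilde\theta(y_i)t_i$ for $\alpha_i\notin\pi_\Theta$. Then $B$ is a left coideal subalgebra of $U$, i.e. $\Delta(B)\subset U\otimes B$.
   Context: $\mathfrak g=\mathfrak n^-\oplus\mathfrak h\oplus\mathfrak n^+$ is a complex semisimple Lie algebra with root system $\Delta$, positive roots $\Delta^+$, simple roots $\pi=\{\alpha_1,\dots,\alpha_n\}$, Cartan inner product $(\ ,\ )$, $a_{ij}=2(\alpha_i,\alpha_j)/(\alpha_i,\alpha_i)$, and Chevalley basis $\{e_\beta,f_{-\beta}:\beta\in\Delta^+\}\cup\{h_1,\dots,h_n\}$, $e_i=e_{\alpha_i}$, $f_i=f_{-\alpha_i}$. $q$ is an indeterminate, $q_i=q^{(\alpha_i,\alpha_i)/2}$. $U=U_q(\mathfrak g)$ is the $\mathbf C(q)$-algebra generated by $x_i,y_i,t_i^{\pm1}$ ($1\le i\le n$) with relations: $x_iy_j-y_jx_i=\delta_{ij}(t_i-t_i^{-1})/(q_i-q_i^{-1})$; the $t_i^{\pm1}$ generate a free abelian group $T$ of rank $n$; $t_ix_j=q^{(\alpha_i,\alpha_j)}x_jt_i$, $t_iy_j=q^{-(\alpha_i,\alpha_j)}y_jt_i$; and the quantum Serre relations $\sum_{m=0}^{1-a_{ij}}(-1)^m\binom{1-a_{ij}}{m}_{q_i}z_i^{1-a_{ij}-m}z_jz_i^m=0$ for $i\ne j$, for $z=x$ and $z=y$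 (symmetric $q$-binomials). It is a Hopf algebra with $\Delta(t)=t\otimes t$, $\epsilon(t)=1$, $\sigma(t)=t^{-1}$ ($t\in T$); $\Delta(x_i)=x_i\otimes1+t_i\otimes x_i$, $\epsilon(x_i)=0$, $\sigma(x_i)=-t_i^{-1}x_i$; $\Delta(y_i)=y_i\otimes t_i^{-1}+1\otimes y_i$, $\epsilon(y_i)=0$, $\sigma(y_i)=-y_it_i$. $\tau$ is the group isomorphism from the root lattice $Q(\pi)$ to $T$ with $\tau(\alpha_i)=t_i$. The right adjoint action is $(\mathrm{ad}_r\,a)b=\sum\sigma(a_{(1)})ba_{(2)}$. Divided powers: $x_i^{(m)}=x_i^m/[m]_{q_i}!$ with $[m]_q=(q^m-q^{-m})/(q-q^{-1})$, and $e_j^{(m)}=e_j^m/m!$. The involution. $\theta$ is a Lie algebra involution of $\mathfrak g$ which is maximally split: with $\mathfrak p=\{v:\theta(v)=-v\}$, $\mathfrak h\cap\mathfrak p$ is a Cartan subspace of $\mathfrak p$ (a commutative subalgebra, reductive in $\mathfrak g$, equal to its centralizer in $\mathfrak p$); $\theta(\mathfrak h)=\mathfrak h$; if $\theta(h_i)=h_i$ then $\theta(e_i)=e_i$ and $\theta(f_i)=f_i$; if $\theta(h_i)\ne h_i$ then $\theta(e_i)$ (resp. $\theta(f_i)$) is a nonzero root vector in $\mathfrak n^-$ (resp. $\mathfrak n^+$). $\Theta$ is the induced automorphism of $\Delta$ (extended linearly), $\pi_\Theta=\{\alpha_i\in\pi:\Theta(\alpha_i)=\alpha_i\}$, $Q^+(\pi_\Theta)$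 the nonnegative integer combinations of $\pi_\Theta$. There is a permutation $p$ of $\{i:\alpha_i\in\pi-\pi_\Theta\}$ with $\Theta(-\alpha_i)-\alpha_{p(i)}\in Q^+(\pi_\Theta)$. $\pi^*\subset\pi-\pi_\Theta$ is a fixed subset containing $\alpha_j$ whenever $p(j)=j$ and exactly one of $\alpha_j,\alpha_{p(j)}$ whenever $p(j)\ne j$. Let $\mathfrak m$ be the Lie subalgebra generated by $e_i,f_i,h_i$ with $\alpha_i\in\pi_\Theta$. For each $\alpha_i\in\pi^*$ fix $\alpha_{i_1},\dots,\alpha_{i_r}\in\pi_\Theta$ and positive integers $m_1,\dots,m_r$ (depending on $i$) such that (after a slight rescaling of $\theta$, assumed made) $\theta(f_i)=(\mathrm{ad}\,e_{i_1}^{(m_1)}\cdots e_{i_r}^{(m_r)})e_{p(i)}$ and each $(\mathrm{ad}\,e_{i_s}^{(m_s)}\cdots e_{i_r}^{(m_r)})e_{p(i)}$ is an extreme vector of the simple $\mathrm{ad}\,\mathfrak m$-module generated by $e_{p(i)}$ (it is a highest weight vector for $\mathrm{ad}\,e_{i_s}$, and $(\mathrm{ad}\,e_{i_{s+1}}^{(m_{s+1})}\cdots e_{i_r}^{(m_r)})e_{p(i)}$ is a lowest weight vector for $\mathrm{ad}\,f_{i_s}$). Put $m(i)=m_1+\cdots+m_r$. $\tilde\theta$ is a $\mathbf C$-algebra automorphism of $U$ satisfying, for $\alpha_i\in\pi^*$, $\tilde\theta(y_i)=(\mathrm{ad}_r\,x_{i_1}^{(m_1)}\cdots x_{i_r}^{(m_r)})t_{p(i)}^{-1}x_{p(i)}$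 and $\tilde\theta(y_{p(i)})=(-1)^{m(i)}(\mathrm{ad}_r\,x_{i_r}^{(m_r)}\cdots x_{i_1}^{(m_1)})t_i^{-1}x_i$ (these values are all that is needed to define $B$). $\mathcal M$ is the subalgebra of $U$ generated by $x_i,y_i,t_i^{\pm1}$ with $\alpha_i\in\pi_\Theta$, and $T_\Theta=\{\tau(\lambda):\Theta(\lambda)=\lambda\}$. *)

theory Defs
  imports
    Complex_Main
    "HOL-Library.Function_Algebras"
    "HOL-Library.Poly_Mapping"
    "HOL-Computational_Algebra.Polynomial"
    "HOL-Computational_Algebra.Fraction_Field"
begin

section \<open>The field of rational functions and quantum integers\<close>

type_synonym Cq = "complex poly fract"

definition qq :: Cq
  where "qq = Fract [:0, 1:] 1"

definition Cq_of :: "complex \<Rightarrow> Cq"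
  where "Cq_of c = Fract [:c:] 1"

definition qint :: "Cq \<Rightarrow> nat \<Rightarrow> Cq"
  where "qint v m = (v ^ m - inverse v ^ m) / (v - inverse v)"

definition qfact :: "Cq \<Rightarrow> nat \<Rightarrow> Cq"
  where "qfact v m = (\<Prod>k=1..m. qint v k)"

definition qbinom :: "Cq \<Rightarrow> nat \<Rightarrow> nat \<Rightarrow> Cq"
  where "qbinom v n k = qfact v n / (qfact v k * qfact v (n - k))"


section \<open>Unital associative algebras over the field of rational functions\<close>

(* The zero algebra is allowed, so that tensor products are again in the class. *)
class cq_algebra = ring + monoid_mult +
  fixes scaleCq :: "Cq \<Rightarrow> 'a \<Rightarrow> 'a"  (infixr \<open>*\<^sub>q\<close> 75)
  assumes scaleCq_right_distrib: "c *\<^sub>q (a + b) = c *\<^sub>q a + c *\<^sub>q b"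
    and scaleCq_left_distrib: "(c + d) *\<^sub>q a = c *\<^sub>q a + d *\<^sub>q a"
    and scaleCq_scaleCq: "c *\<^sub>q d *\<^sub>q a = (c * d) *\<^sub>q a"
    and scaleCq_one: "1 *\<^sub>q a = a"
    and scaleCq_mult_left: "(c *\<^sub>q a) * b = c *\<^sub>q (a * b)"
    and scaleCq_mult_right: "a * (c *\<^sub>q b) = c *\<^sub>q (a * b)"

definition cq_linear :: "('a::cq_algebra \<Rightarrow> 'b::cq_algebra) \<Rightarrow> bool"
  where "cq_linear f \<longleftrightarrow>
    (\<forall>a b. f (a + b) = f a + f b) \<and> (\<forall>c a. f (c *\<^sub>q a) = c *\<^sub>q f a)"

definition cq_alg_hom :: "('a::cq_algebra \<Rightarrow> 'b::cq_algebra) \<Rightarrow> bool"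
  where "cq_alg_hom f \<longleftrightarrow>
    cq_linear f \<and> f 1 = 1 \<and> (\<forall>a b. f (a * b) = f a * f b)"

definition cq_subalgebra :: "'a::cq_algebra set \<Rightarrow> bool"
  where "cq_subalgebra A \<longleftrightarrow>
    1 \<in> A \<and> (\<forall>a\<in>A. \<forall>b\<in>A. a + b \<in> A) \<and> (\<forall>a\<in>A. \<forall>b\<in>A. a * b \<in> A) \<and>
    (\<forall>c. \<forall>a\<in>A. c *\<^sub>q a \<in> A)"

(* Linear over the complex numbers only: q need not be fixed. *)
definition complex_algebra_automorphism :: "('a::cq_algebra \<Rightarrow> 'a) \<Rightarrow> bool"
  where "complex_algebra_automorphism f \<longleftrightarrow>
    bij f \<and> f 1 = 1 \<and> (\<forall>a b. f (a + b) = f a + f b) \<and> (\<forall>a b. f (a * b) = f a * f b) \<and>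
    (\<forall>c a. f (Cq_of c *\<^sub>q a) = Cq_of c *\<^sub>q f a)"

definition cq_span :: "'a::cq_algebra set \<Rightarrow> 'a set"
  where "cq_span S = {\<Sum>a\<in>A. f a *\<^sub>q a | A f. finite A \<and> A \<subseteq> S}"


section \<open>Tensor products\<close>

(* The multiplicative monoid of pairs in additive notation: Poly_Mapping forms the monoid algebra
   of an additively written monoid. Its monoid algebra is the free vector space on the pairs,
   with the product determined by (a, b) (a', b') = (a a', b b'). *)
datatype ('a, 'b) mpair = MPair 'a 'b

instantiation mpair :: (monoid_mult, monoid_mult) monoid_add
begin

definition "0 = MPair 1 1"

definition "r + s = (case r of MPair a b \<Rightarrow> case s of MPair a' b' \<Rightarrow> MPair (a * a') (b * b'))"

instance
  by standard (auto simp: zero_mpair_def plus_mpair_def mult.assoc split: mpair.splits)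

end

inductive_set tensor_null :: "(('a::cq_algebra, 'b::cq_algebra) mpair \<Rightarrow>\<^sub>0 Cq) set"
  where
    zero: "0 \<in> tensor_null"
  | add: "f \<in> tensor_null \<Longrightarrow> g \<in> tensor_null \<Longrightarrow> f + g \<in> tensor_null"
  | add_left: "Poly_Mapping.single (MPair (a + a') b) c - Poly_Mapping.single (MPair a b) c
      - Poly_Mapping.single (MPair a' b) c \<in> tensor_null"
  | add_right: "Poly_Mapping.single (MPair a (b + b')) c - Poly_Mapping.single (MPair a b) c
      - Poly_Mapping.single (MPair a b') c \<in> tensor_null"
  | scale_left: "Poly_Mapping.single (MPair (d *\<^sub>q a) b) c
      - Poly_Mapping.single (MPair a b) (c * d) \<in> tensor_null"
  | scale_right: "Poly_Mapping.single (MPair a (d *\<^sub>q b)) c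
      - Poly_Mapping.single (MPair a b) (c * d) \<in> tensor_null"

lemma tensor_null_mult_single:
  assumes "f \<in> tensor_null"
  shows "Poly_Mapping.single s e * f \<in> tensor_null" "f * Poly_Mapping.single s e \<in> tensor_null"
proof -
  obtain x y where s: "s = MPair x y" by (cases s)
  show "Poly_Mapping.single s e * f \<in> tensor_null"
    using assms
  proof induction
    case (scale_left d a b c)
    show ?case
      using tensor_null.scale_left[of d "x * a" "y * b" "e * c"]
      by (simp add: s algebra_simps mult_single plus_mpair_def scaleCq_mult_right)
  next
    case (scale_right a d b c)
    show ?case
      using tensor_null.scale_right[of "x * a" d "y * b" "e * c"]
      by (simp add: s algebra_simps mult_single plus_mpair_def scaleCq_mult_right)
  next
    case (add_left a a' b c)
    show ?case
      using tensor_null.add_left[of "x * a" "x * a'" "y * b" "e * c"]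
      by (simp add: s right_diff_distrib distrib_left mult_single plus_mpair_def)
  next
    case (add_right a b b' c)
    show ?case
      using tensor_null.add_right[of "x * a" "y * b" "y * b'" "e * c"]
      by (simp add: s right_diff_distrib distrib_left mult_single plus_mpair_def)
  qed (simp_all add: tensor_null.zero tensor_null.add distrib_left)
  show "f * Poly_Mapping.single s e \<in> tensor_null"
    using assms
  proof induction
    case (scale_left d a b c)
    show ?case
      using tensor_null.scale_left[of d "a * x" "b * y" "c * e"]
      by (simp add: s algebra_simps mult_single plus_mpair_def scaleCq_mult_left)
  next
    case (scale_right a d b c)
    show ?case
      using tensor_null.scale_right[of "a * x" d "b * y" "c * e"]
      by (simp add: s algebra_simps mult_single plus_mpair_def scaleCq_mult_left)
  next
    case (add_left a a' b c)
    show ?case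
      using tensor_null.add_left[of "a * x" "a' * x" "b * y" "c * e"]
      by (simp add: s left_diff_distrib distrib_right mult_single plus_mpair_def)
  next
    case (add_right a b b' c)
    show ?case
      using tensor_null.add_right[of "a * x" "b * y" "b' * y" "c * e"]
      by (simp add: s left_diff_distrib distrib_right mult_single plus_mpair_def)
  qed (simp_all add: tensor_null.zero tensor_null.add distrib_right)
qed

lemma tensor_null_mult:
  assumes "f \<in> tensor_null"
  shows "g * f \<in> tensor_null" "f * g \<in> tensor_null"
proof -
  have "g * f \<in> tensor_null \<and> f * g \<in> tensor_null"
  proof (induction g rule: update_induct)
    case const
    then show ?case by (simp add: tensor_null.zero)
  next
    case (update p k v)
    have "Poly_Mapping.update k v p = Poly_Mapping.single k v + p"
      using update.hyps
      by (intro poly_mapping_eqI) (auto simp: lookup_update lookup_add lookup_single in_keys_iff)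
    then show ?case
      using update.IH tensor_null_mult_single[OF assms]
      by (simp add: distrib_left distrib_right tensor_null.add)
  qed
  then show "g * f \<in> tensor_null" "f * g \<in> tensor_null" by auto
qed

lemma tensor_null_uminus: "f \<in> tensor_null \<Longrightarrow> - f \<in> tensor_null"
  using tensor_null_mult(1)[of f "- 1"] by simp

lemma tensor_null_diff: "f \<in> tensor_null \<Longrightarrow> g \<in> tensor_null \<Longrightarrow> f - g \<in> tensor_null"
  using tensor_null.add[of f "- g"] tensor_null_uminus[of g] by simp

definition tensor_rel ::
    "(('a::cq_algebra, 'b::cq_algebra) mpair \<Rightarrow>\<^sub>0 Cq) \<Rightarrow> (('a, 'b) mpair \<Rightarrow>\<^sub>0 Cq) \<Rightarrow> bool"
  where "tensor_rel f g \<longleftrightarrow> f - g \<in> tensor_null"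

lemma equivp_tensor_rel:
  "equivp (tensor_rel :: (('a::cq_algebra, 'b::cq_algebra) mpair \<Rightarrow>\<^sub>0 Cq) \<Rightarrow> _)"
proof (rule equivpI)
  let ?R = "tensor_rel :: (('a, 'b) mpair \<Rightarrow>\<^sub>0 Cq) \<Rightarrow> _"
  show "reflp ?R" by (auto simp: reflp_def tensor_rel_def tensor_null.zero)
  show "symp ?R"
    unfolding symp_def tensor_rel_def
    by (intro allI impI) (metis minus_diff_eq tensor_null_uminus)
  show "transp ?R"
  proof (rule transpI)
    fix f g h :: "('a, 'b) mpair \<Rightarrow>\<^sub>0 Cq"
    assume "tensor_rel f g" "tensor_rel g h"
    then have "(f - g) + (g - h) \<in> tensor_null"
      unfolding tensor_rel_def by (rule tensor_null.add)
    then show "tensor_rel f h" by (simp add: tensor_rel_def)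
  qed
qed

quotient_type (overloaded) ('a, 'b) tensor =
  "('a::cq_algebra, 'b::cq_algebra) mpair \<Rightarrow>\<^sub>0 Cq" / tensor_rel
  by (rule equivp_tensor_rel)

lemma tensor_rel_refl: "tensor_rel f f"
  by (simp add: tensor_rel_def tensor_null.zero)

lemma single_zero_commute:
  fixes f :: "'a::monoid_add \<Rightarrow>\<^sub>0 Cq"
  shows "f * Poly_Mapping.single 0 c = Poly_Mapping.single 0 c * f"
proof (induction f rule: update_induct)
  case const
  then show ?case by simp
next
  case (update p k v)
  have "Poly_Mapping.update k v p = Poly_Mapping.single k v + p"
    using update.hyps
    by (intro poly_mapping_eqI) (auto simp: lookup_update lookup_add lookup_single in_keys_iff)
  then show ?case
    using update.IH by (simp add: distrib_left distrib_right mult_single mult.commute)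
qed

instantiation tensor :: (cq_algebra, cq_algebra) cq_algebra
begin

lift_definition zero_tensor :: "('a, 'b) tensor" is 0 .

lift_definition one_tensor :: "('a, 'b) tensor" is 1 .

lift_definition uminus_tensor :: "('a, 'b) tensor \<Rightarrow> ('a, 'b) tensor" is uminus
  unfolding tensor_rel_def using tensor_null_uminus by force

lift_definition plus_tensor :: "('a, 'b) tensor \<Rightarrow> ('a, 'b) tensor \<Rightarrow> ('a, 'b) tensor" is plus
  unfolding tensor_rel_def by (simp add: add_diff_add tensor_null.add)

lift_definition minus_tensor :: "('a, 'b) tensor \<Rightarrow> ('a, 'b) tensor \<Rightarrow> ('a, 'b) tensor" is minus
proof -
  fix f f' g g' :: "('a, 'b) mpair \<Rightarrow>\<^sub>0 Cq"
  assume "tensor_rel f f'" "tensor_rel g g'"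
  then have "(f - f') - (g - g') \<in> tensor_null"
    unfolding tensor_rel_def by (rule tensor_null_diff)
  then show "tensor_rel (f - g) (f' - g')"
    by (simp add: tensor_rel_def algebra_simps)
qed

lift_definition times_tensor :: "('a, 'b) tensor \<Rightarrow> ('a, 'b) tensor \<Rightarrow> ('a, 'b) tensor" is times
proof -
  fix f f' g g' :: "('a, 'b) mpair \<Rightarrow>\<^sub>0 Cq"
  assume "tensor_rel f f'" "tensor_rel g g'"
  then have "(f - f') * g + f' * (g - g') \<in> tensor_null"
    unfolding tensor_rel_def by (intro tensor_null.add tensor_null_mult)
  then show "tensor_rel (f * g) (f' * g')"
    by (simp add: tensor_rel_def left_diff_distrib right_diff_distrib)
qed

definition scaleCq_tensor :: "Cq \<Rightarrow> ('a, 'b) tensor \<Rightarrow> ('a, 'b) tensor"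
  where "c *\<^sub>q z = abs_tensor (Poly_Mapping.single 0 c) * z"

instance
proof
  fix a b c :: "('a, 'b) tensor" and d e :: Cq
  show "a + b + c = a + (b + c)"
    by transfer (simp add: tensor_rel_refl add.assoc)
  show "a + b = b + a"
    by transfer (simp add: tensor_rel_refl add.commute)
  show "0 + a = a"
    by transfer (simp add: tensor_rel_refl)
  show "- a + a = 0"
    by transfer (simp add: tensor_rel_refl)
  show "a - b = a + - b"
    by transfer (simp add: tensor_rel_refl)
  show assoc: "a * b * c = a * (b * c)" for a b c :: "('a, 'b) tensor"
    by transfer (simp add: tensor_rel_refl mult.assoc)
  show distr: "(a + b) * c = a * c + b * c" for a b c :: "('a, 'b) tensor"
    by transfer (simp add: tensor_rel_refl distrib_right)
  show distl: "a * (b + c) = a * b + a * c" for a b c :: "('a, 'b) tensor"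
    by transfer (simp add: tensor_rel_refl distrib_left)
  show one: "1 * a = a" for a :: "('a, 'b) tensor"
    by transfer (simp add: tensor_rel_refl)
  show "a * 1 = a"
    by transfer (simp add: tensor_rel_refl)
  show "d *\<^sub>q (a + b) = d *\<^sub>q a + d *\<^sub>q b"
    by (simp add: scaleCq_tensor_def distl)
  show "(d + e) *\<^sub>q a = d *\<^sub>q a + e *\<^sub>q a"
    by (simp add: scaleCq_tensor_def single_add flip: distr plus_tensor.abs_eq)
  show "d *\<^sub>q e *\<^sub>q a = (d * e) *\<^sub>q a"
    by (simp add: scaleCq_tensor_def times_tensor.abs_eq mult_single flip: assoc)
  show "1 *\<^sub>q a = a"
    by (metis scaleCq_tensor_def one one_tensor.abs_eq single_one)
  show "(d *\<^sub>q a) * b = d *\<^sub>q (a * b)"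
    by (simp add: scaleCq_tensor_def assoc)
  have "a * abs_tensor (Poly_Mapping.single 0 d) = abs_tensor (Poly_Mapping.single 0 d) * a"
    by (induction a rule: tensor.abs_induct)
      (simp add: times_tensor.abs_eq single_zero_commute)
  then show "a * (d *\<^sub>q b) = d *\<^sub>q (a * b)"
    by (simp add: scaleCq_tensor_def flip: assoc)
qed

end

lift_definition tens :: "'a::cq_algebra \<Rightarrow> 'b::cq_algebra \<Rightarrow> ('a, 'b) tensor"  (infixr \<open>\<otimes>\<close> 72)
  is "\<lambda>a b. Poly_Mapping.single (MPair a b) 1" .

(* The linear map induced by a bilinear map f (the choice of representative is then irrelevant). *)
definition tensor_lift ::
    "('a::cq_algebra \<Rightarrow> 'b::cq_algebra \<Rightarrow> 'c::cq_algebra) \<Rightarrow> ('a, 'b) tensor \<Rightarrow> 'c"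
  where "tensor_lift f z = (let r = rep_tensor z in
    \<Sum>s\<in>Poly_Mapping.keys r. case s of MPair a b \<Rightarrow> Poly_Mapping.lookup r s *\<^sub>q f a b)"


section \<open>Hopf algebras and left coideal subalgebras\<close>

definition hopf_algebra ::
    "('u::cq_algebra \<Rightarrow> ('u, 'u) tensor) \<Rightarrow> ('u \<Rightarrow> Cq) \<Rightarrow> ('u \<Rightarrow> 'u) \<Rightarrow> bool"
  where "hopf_algebra \<Delta> \<epsilon> \<sigma> \<longleftrightarrow>
    cq_alg_hom \<Delta> \<and>
    \<epsilon> 1 = 1 \<and> (\<forall>a b. \<epsilon> (a + b) = \<epsilon> a + \<epsilon> b) \<and> (\<forall>a b. \<epsilon> (a * b) = \<epsilon> a * \<epsilon> b) \<and>
    (\<forall>c a. \<epsilon> (c *\<^sub>q a) = c * \<epsilon> a) \<and>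
    cq_linear \<sigma> \<and>
    (\<forall>u. tensor_lift (\<lambda>a b. tensor_lift (\<lambda>a' a''. a' \<otimes> (a'' \<otimes> b)) (\<Delta> a)) (\<Delta> u) =
         tensor_lift (\<lambda>a b. a \<otimes> \<Delta> b) (\<Delta> u)) \<and>
    (\<forall>u. tensor_lift (\<lambda>a b. \<epsilon> a *\<^sub>q b) (\<Delta> u) = u) \<and>
    (\<forall>u. tensor_lift (\<lambda>a b. \<epsilon> b *\<^sub>q a) (\<Delta> u) = u) \<and>
    (\<forall>u. tensor_lift (\<lambda>a b. \<sigma> a * b) (\<Delta> u) = \<epsilon> u *\<^sub>q 1) \<and>
    (\<forall>u. tensor_lift (\<lambda>a b. a * \<sigma> b) (\<Delta> u) = \<epsilon> u *\<^sub>q 1)"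

definition ad_r ::
    "('u::cq_algebra \<Rightarrow> ('u, 'u) tensor) \<Rightarrow> ('u \<Rightarrow> 'u) \<Rightarrow> 'u \<Rightarrow> 'u \<Rightarrow> 'u"
  where "ad_r \<Delta> \<sigma> a b = tensor_lift (\<lambda>a' a''. \<sigma> a' * b * a'') (\<Delta> a)"

definition left_coideal_subalgebra ::
    "('u::cq_algebra \<Rightarrow> ('u, 'u) tensor) \<Rightarrow> 'u set \<Rightarrow> bool"
  where "left_coideal_subalgebra \<Delta> B \<longleftrightarrow>
    cq_subalgebra B \<and> \<Delta> ` B \<subseteq> cq_span {u \<otimes> b | u b. b \<in> B}"


section \<open>Complex Lie algebras\<close>

locale lie_algebra = vector_space scale
  for scale :: "complex \<Rightarrow> 'g::ab_group_add \<Rightarrow> 'g" +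
  fixes br :: "'g \<Rightarrow> 'g \<Rightarrow> 'g"
  assumes br_add_left: "br (a + b) c = br a c + br b c"
    and br_add_right: "br a (b + c) = br a b + br a c"
    and br_scale_left: "br (scale k a) b = scale k (br a b)"
    and br_scale_right: "br a (scale k b) = scale k (br a b)"
    and br_self: "br a a = 0"
    and jacobi: "br a (br b c) + br b (br c a) + br c (br a b) = 0"
begin

definition lie_subalgebra :: "'g set \<Rightarrow> bool"
  where "lie_subalgebra S \<longleftrightarrow> subspace S \<and> (\<forall>a\<in>S. \<forall>b\<in>S. br a b \<in> S)"

definition lie_ideal :: "'g set \<Rightarrow> bool"
  where "lie_ideal S \<longleftrightarrow> subspace S \<and> (\<forall>a. \<forall>b\<in>S. br a b \<in> S)"

definition bracket_span :: "'g set \<Rightarrow> 'g set \<Rightarrow> 'g set"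
  where "bracket_span A B = span {br a b | a b. a \<in> A \<and> b \<in> B}"

definition lie_solvable :: "'g set \<Rightarrow> bool"
  where "lie_solvable S \<longleftrightarrow> (\<exists>k. ((\<lambda>A. bracket_span A A) ^^ k) S = {0})"

definition lie_nilpotent :: "'g set \<Rightarrow> bool"
  where "lie_nilpotent S \<longleftrightarrow> (\<exists>k. (bracket_span S ^^ k) S = {0})"

definition semisimple :: bool
  where "semisimple \<longleftrightarrow> (\<forall>I. lie_ideal I \<and> lie_solvable I \<longrightarrow> I = {0})"

definition cartan_subalgebra :: "'g set \<Rightarrow> bool"
  where "cartan_subalgebra S \<longleftrightarrow>
    lie_subalgebra S \<and> lie_nilpotent S \<and> {v. \<forall>a\<in>S. br v a \<in> S} = S"

definition ad_submodule :: "'g set \<Rightarrow> 'g set \<Rightarrow> bool"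
  where "ad_submodule A V \<longleftrightarrow> subspace V \<and> (\<forall>a\<in>A. \<forall>v\<in>V. br a v \<in> V)"

definition simple_ad_module :: "'g set \<Rightarrow> 'g set \<Rightarrow> bool"
  where "simple_ad_module A V \<longleftrightarrow>
    ad_submodule A V \<and> V \<noteq> {0} \<and> (\<forall>W. ad_submodule A W \<and> W \<subseteq> V \<longrightarrow> W = {0} \<or> W = V)"

(* The adjoint action of A on the whole Lie algebra is completely reducible. *)
definition reductive_in :: "'g set \<Rightarrow> bool"
  where "reductive_in A \<longleftrightarrow> lie_subalgebra A \<and>
    (\<forall>V. ad_submodule A V \<longrightarrow>
      (\<exists>W. ad_submodule A W \<and> V \<inter> W = {0} \<and> {v + w | v w. v \<in> V \<and> w \<in> W} = UNIV))"

definition cartan_subspace :: "'g set \<Rightarrow> 'g set \<Rightarrow> bool"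
  where "cartan_subspace P A \<longleftrightarrow>
    A \<subseteq> P \<and> lie_subalgebra A \<and> (\<forall>a\<in>A. \<forall>b\<in>A. br a b = 0) \<and> reductive_in A \<and>
    {v \<in> P. \<forall>a\<in>A. br v a = 0} = A"

definition root_space :: "'g set \<Rightarrow> ('g \<Rightarrow> complex) \<Rightarrow> 'g set"
  where "root_space H l = {v. \<forall>h\<in>H. br h v = scale (l h) v}"

end


section \<open>Roots, Chevalley bases and maximally split involutions\<close>

(* An element of the root lattice is given by its integer coordinates with respect to the simple
   roots; weight translates it into a functional on the Cartan subalgebra. Such functionals are
   total functions whose values outside the Cartan subalgebra are irrelevant. *)
definition simple_root :: "'i \<Rightarrow> 'i \<Rightarrow> int"
  where "simple_root i = (\<lambda>j. if j = i then 1 else 0)"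

definition weight :: "('i::finite \<Rightarrow> 'g \<Rightarrow> complex) \<Rightarrow> ('i \<Rightarrow> int) \<Rightarrow> 'g \<Rightarrow> complex"
  where "weight \<alpha> c h = (\<Sum>i\<in>UNIV. of_int (c i) * \<alpha> i h)"

(* The involution acts on functionals by precomposition (it equals its own inverse). *)
definition Theta ::
    "'g set \<Rightarrow> ('i::finite \<Rightarrow> 'g \<Rightarrow> complex) \<Rightarrow> ('g \<Rightarrow> 'g) \<Rightarrow> ('i \<Rightarrow> int) \<Rightarrow> 'i \<Rightarrow> int"
  where "Theta H \<alpha> \<theta> c = (THE d. \<forall>h\<in>H. weight \<alpha> d h = weight \<alpha> c (\<theta> h))"

definition pi_Theta ::
    "'g set \<Rightarrow> ('i::finite \<Rightarrow> 'g \<Rightarrow> complex) \<Rightarrow> ('g \<Rightarrow> 'g) \<Rightarrow> 'i set"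
  where "pi_Theta H \<alpha> \<theta> = {i. Theta H \<alpha> \<theta> (simple_root i) = simple_root i}"

definition Q_plus :: "'i set \<Rightarrow> ('i \<Rightarrow> int) set"
  where "Q_plus S = {c. (\<forall>i. 0 \<le> c i) \<and> (\<forall>i. i \<notin> S \<longrightarrow> c i = 0)}"

locale chevalley_data = lie_algebra scale br
  for scale :: "complex \<Rightarrow> 'g::ab_group_add \<Rightarrow> 'g" and br :: "'g \<Rightarrow> 'g \<Rightarrow> 'g" +
  fixes H :: "'g set"
    and \<alpha> :: "'i::finite \<Rightarrow> 'g \<Rightarrow> complex"
    and E :: "('i \<Rightarrow> int) \<Rightarrow> 'g"  \<comment> \<open>root vectors: for positive \<open>\<beta>\<close>, \<open>e\<^sub>\<beta> = E \<beta>\<close> and \<open>f\<^sub>-\<^sub>\<beta> = E (- \<beta>)\<close>\<close>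
    and ip :: "'i \<Rightarrow> 'i \<Rightarrow> int"  \<comment> \<open>Gram matrix of the Cartan inner product on the simple roots\<close>
begin

definition roots :: "('i \<Rightarrow> int) set"
  where "roots = {c. c \<noteq> 0 \<and> root_space H (weight \<alpha> c) \<noteq> {0}}"

definition pos_roots :: "('i \<Rightarrow> int) set"
  where "pos_roots = roots \<inter> Q_plus UNIV"

definition base :: bool
  where "base \<longleftrightarrow>
    (\<forall>k::'i \<Rightarrow> complex. (\<forall>h\<in>H. (\<Sum>i\<in>UNIV. k i * \<alpha> i h) = 0) \<longrightarrow> (\<forall>i. k i = 0)) \<and>
    (\<forall>i. simple_root i \<in> roots) \<and>
    (\<forall>l. (\<exists>h\<in>H. l h \<noteq> 0) \<and> root_space H l \<noteq> {0} \<longrightarrow>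
      (\<exists>c. (c \<in> Q_plus UNIV \<or> - c \<in> Q_plus UNIV) \<and> (\<forall>h\<in>H. l h = weight \<alpha> c h)))"

definition e :: "'i \<Rightarrow> 'g"
  where "e i = E (simple_root i)"

definition f :: "'i \<Rightarrow> 'g"
  where "f i = E (- simple_root i)"

definition h :: "'i \<Rightarrow> 'g"
  where "h i = br (e i) (f i)"

(* The root spaces are one-dimensional, so the second condition says that [E b, E (-b)] is the
   coroot of b; in particular h i is the coroot of the i-th simple root. *)
definition chevalley_basis :: bool
  where "chevalley_basis \<longleftrightarrow>
    (\<forall>b\<in>roots. E b \<in> root_space H (weight \<alpha> b)) \<and>
    (\<forall>b\<in>roots. weight \<alpha> b (br (E b) (E (- b))) = 2) \<and>
    (\<forall>b\<in>roots. \<forall>b'\<in>roots. b + b' \<in> roots \<longrightarrow>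
      (\<exists>k. br (E b) (E b') = scale k (E (b + b')) \<and>
           br (E (- b)) (E (- b')) = scale (- k) (E (- (b + b'))))) \<and>
    independent (E ` roots \<union> range h) \<and> span (E ` roots \<union> range h) = UNIV"

end

(* The relation between ip and the coroots says that the Cartan integers
   2 (alpha_i, alpha_j) / (alpha_i, alpha_i) are the values alpha_j (h_i). This fixes the inner
   product up to a positive factor on each simple component; any scaling with integral values
   and even squared lengths, such as the one with (alpha, alpha) = 2 for short roots, is allowed,
   so that the powers of q in the definition of the quantized algebra make sense. *)
locale semisimple_chevalley_data = chevalley_data scale br H \<alpha> E ip
  for scale :: "complex \<Rightarrow> 'g::ab_group_add \<Rightarrow> 'g" and br :: "'g \<Rightarrow> 'g \<Rightarrow> 'g"
    and H :: "'g set" and \<alpha> :: "'i::finite \<Rightarrow> 'g \<Rightarrow> complex"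
    and E :: "('i \<Rightarrow> int) \<Rightarrow> 'g" and ip :: "'i \<Rightarrow> 'i \<Rightarrow> int" +
  assumes finite_dimensional: "\<exists>S. finite S \<and> span S = UNIV"
    and semisimple: "semisimple"
    and cartan: "cartan_subalgebra H"
    and base: "base"
    and chevalley_basis: "chevalley_basis"
    and ip_sym: "ip i j = ip j i"
    and ip_pos: "ip i i > 0"
    and ip_even: "even (ip i i)"
    and ip_coroot: "of_int (2 * ip i j) = of_int (ip i i) * \<alpha> j (h i)"

locale maximally_split_involution = semisimple_chevalley_data scale br H \<alpha> E ip
  for scale :: "complex \<Rightarrow> 'g::ab_group_add \<Rightarrow> 'g" and br :: "'g \<Rightarrow> 'g \<Rightarrow> 'g"
    and H :: "'g set" and \<alpha> :: "'i::finite \<Rightarrow> 'g \<Rightarrow> complex"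
    and E :: "('i \<Rightarrow> int) \<Rightarrow> 'g" and ip :: "'i \<Rightarrow> 'i \<Rightarrow> int" +
  fixes \<theta> :: "'g \<Rightarrow> 'g"
  assumes theta_add: "\<theta> (a + b) = \<theta> a + \<theta> b"
    and theta_scale: "\<theta> (scale k a) = scale k (\<theta> a)"
    and theta_br: "\<theta> (br a b) = br (\<theta> a) (\<theta> b)"
    and theta_theta: "\<theta> (\<theta> a) = a"
    and theta_H: "\<theta> ` H = H"
    and theta_cartan_subspace: "cartan_subspace {v. \<theta> v = - v} (H \<inter> {v. \<theta> v = - v})"
    and theta_fixed: "\<theta> (h i) = h i \<Longrightarrow> \<theta> (e i) = e i \<and> \<theta> (f i) = f i"
    and theta_not_fixed_e: "\<theta> (h i) \<noteq> h i \<Longrightarrow>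
      \<exists>b\<in>pos_roots. \<theta> (e i) \<in> root_space H (weight \<alpha> (- b)) - {0}"
    and theta_not_fixed_f: "\<theta> (h i) \<noteq> h i \<Longrightarrow>
      \<exists>b\<in>pos_roots. \<theta> (f i) \<in> root_space H (weight \<alpha> b) - {0}"
begin

abbreviation black :: "'i set"
  where "black \<equiv> pi_Theta H \<alpha> \<theta>"

definition levi :: "'g set"
  where "levi = lie_subalgebra hull (e ` black \<union> f ` black \<union> h ` black)"

(* The word [(i1, m1), ..., (ir, mr)] stands for
   ad e_i1^(m1) ... e_ir^(mr), whose last letter acts first. *)
definition ad_word :: "('i \<times> nat) list \<Rightarrow> 'g \<Rightarrow> 'g"
  where "ad_word w v = foldr (\<lambda>(j, m) u. scale (1 / fact m) ((br (e j) ^^ m) u)) w v"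

definition highest_weight_vector :: "'i \<Rightarrow> 'g \<Rightarrow> bool"
  where "highest_weight_vector j v \<longleftrightarrow>
    v \<noteq> 0 \<and> (\<exists>k. br (h j) v = scale k v) \<and> br (e j) v = 0"

definition lowest_weight_vector :: "'i \<Rightarrow> 'g \<Rightarrow> bool"
  where "lowest_weight_vector j v \<longleftrightarrow>
    v \<noteq> 0 \<and> (\<exists>k. br (h j) v = scale k v) \<and> br (f j) v = 0"

definition extreme_word :: "'i \<Rightarrow> ('i \<times> nat) list \<Rightarrow> bool"
  where "extreme_word j w \<longleftrightarrow> (let V = ad_submodule levi hull {e j} in
    simple_ad_module levi V \<and>
    (\<forall>s<length w.
      ad_word (drop s w) (e j) \<in> V \<and>
      highest_weight_vector (fst (w ! s)) (ad_word (drop s w) (e j)) \<and>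
      lowest_weight_vector (fst (w ! s)) (ad_word (drop (Suc s) w) (e j))))"

end

locale symmetric_pair_data = maximally_split_involution scale br H \<alpha> E ip \<theta>
  for scale :: "complex \<Rightarrow> 'g::ab_group_add \<Rightarrow> 'g" and br :: "'g \<Rightarrow> 'g \<Rightarrow> 'g"
    and H :: "'g set" and \<alpha> :: "'i::finite \<Rightarrow> 'g \<Rightarrow> complex"
    and E :: "('i \<Rightarrow> int) \<Rightarrow> 'g" and ip :: "'i \<Rightarrow> 'i \<Rightarrow> int" and \<theta> :: "'g \<Rightarrow> 'g" +
  fixes p :: "'i \<Rightarrow> 'i"
    and pi_star :: "'i set"
    and w :: "'i \<Rightarrow> ('i \<times> nat) list"
  assumes p_bij: "bij_betw p (- black) (- black)"
    and p_Theta: "i \<notin> black \<Longrightarrow>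
      Theta H \<alpha> \<theta> (- simple_root i) - simple_root (p i) \<in> Q_plus black"
    and pi_star_subset: "pi_star \<subseteq> - black"
    and pi_star_fixed: "j \<notin> black \<Longrightarrow> p j = j \<Longrightarrow> j \<in> pi_star"
    and pi_star_moved: "j \<notin> black \<Longrightarrow> p j \<noteq> j \<Longrightarrow> (j \<in> pi_star) \<noteq> (p j \<in> pi_star)"
    and word_black: "i \<in> pi_star \<Longrightarrow> fst ` set (w i) \<subseteq> black"
    and word_pos: "i \<in> pi_star \<Longrightarrow> \<forall>m\<in>snd ` set (w i). 0 < m"
    and theta_word: "i \<in> pi_star \<Longrightarrow> \<theta> (f i) = ad_word (w i) (e (p i))"
    and word_extreme: "i \<in> pi_star \<Longrightarrow> extreme_word (p i) (w i)"


section \<open>The quantized enveloping algebra\<close>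

datatype 'a fword = Word "'a list"

instantiation fword :: (type) monoid_add
begin

definition "0 = Word []"

definition "v + w = (case v of Word xs \<Rightarrow> case w of Word ys \<Rightarrow> Word (xs @ ys))"

instance
  by standard (auto simp: zero_fword_def plus_fword_def split: fword.splits)

end

(* The free algebra is the monoid algebra of the free monoid (in additive notation). *)
type_synonym 'a free_algebra = "'a fword \<Rightarrow>\<^sub>0 Cq"

definition fgen :: "'a \<Rightarrow> 'a free_algebra"
  where "fgen a = Poly_Mapping.single (Word [a]) 1"

definition fconst :: "Cq \<Rightarrow> 'a free_algebra"
  where "fconst c = Poly_Mapping.single 0 c"

definition feval :: "('a \<Rightarrow> 'u::cq_algebra) \<Rightarrow> 'a free_algebra \<Rightarrow> 'u"
  where "feval \<phi> r = (\<Sum>v\<in>Poly_Mapping.keys r.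
    case v of Word xs \<Rightarrow> Poly_Mapping.lookup r v *\<^sub>q prod_list (map \<phi> xs))"

definition two_sided_ideal :: "'r::ring_1 set \<Rightarrow> bool"
  where "two_sided_ideal I \<longleftrightarrow>
    0 \<in> I \<and> (\<forall>a\<in>I. \<forall>b\<in>I. a + b \<in> I) \<and> (\<forall>a\<in>I. \<forall>r. r * a \<in> I \<and> a * r \<in> I)"

(* The algebra 'u is generated by the elements \<phi> a with defining relations r = 0, r in R. *)
definition presented_by :: "('a \<Rightarrow> 'u::cq_algebra) \<Rightarrow> 'a free_algebra set \<Rightarrow> bool"
  where "presented_by \<phi> R \<longleftrightarrow>
    surj (feval \<phi>) \<and> {r. feval \<phi> r = 0} = two_sided_ideal hull R"

datatype 'i generator = GX 'i | GY 'i | GT 'i | GTinv 'i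

definition cartan_int :: "('i \<Rightarrow> 'i \<Rightarrow> int) \<Rightarrow> 'i \<Rightarrow> 'i \<Rightarrow> int"
  where "cartan_int ip i j = 2 * ip i j div ip i i"

definition q_of :: "('i \<Rightarrow> 'i \<Rightarrow> int) \<Rightarrow> 'i \<Rightarrow> Cq"
  where "q_of ip i = qq powi (ip i i div 2)"

definition serre :: "('i \<Rightarrow> 'i \<Rightarrow> int) \<Rightarrow> ('i \<Rightarrow> 'a) \<Rightarrow> 'i \<Rightarrow> 'i \<Rightarrow> 'a free_algebra"
  where "serre ip g i j = (let N = nat (1 - cartan_int ip i j) in
    \<Sum>m\<le>N. fconst ((- 1) ^ m * qbinom (q_of ip i) N m) *
      fgen (g i) ^ (N - m) * fgen (g j) * fgen (g i) ^ m)"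

definition Uq_relations :: "('i \<Rightarrow> 'i \<Rightarrow> int) \<Rightarrow> 'i generator free_algebra set"
  where "Uq_relations ip =
    {fgen (GX i) * fgen (GY j) - fgen (GY j) * fgen (GX i) -
       (if i = j then fconst (1 / (q_of ip i - inverse (q_of ip i))) * (fgen (GT i) - fgen (GTinv i))
        else 0) | i j. True} \<union>
    {fgen (GT i) * fgen (GT j) - fgen (GT j) * fgen (GT i) | i j. True} \<union>
    {fgen (GT i) * fgen (GTinv i) - 1 | i. True} \<union>
    {fgen (GTinv i) * fgen (GT i) - 1 | i. True} \<union>
    {fgen (GT i) * fgen (GX j) - fconst (qq powi ip i j) * fgen (GX j) * fgen (GT i) | i j. True} \<union>
    {fgen (GT i) * fgen (GY j) - fconst (qq powi (- ip i j)) * fgen (GY j) * fgen (GT i) | i j. True} \<union>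
    {serre ip GX i j | i j. i \<noteq> j} \<union>
    {serre ip GY i j | i j. i \<noteq> j}"

definition torus :: "('i \<Rightarrow> 'u::cq_algebra) \<Rightarrow> ('i \<Rightarrow> 'u) \<Rightarrow> 'u set"
  where "torus t tinv =
    (\<lambda>S. 1 \<in> S \<and> (\<forall>a\<in>S. \<forall>b\<in>S. a * b \<in> S)) hull (range t \<union> range tinv)"

(* The bijectivity of tau expresses that the t_i freely generate the group T. *)
locale quantized_enveloping_algebra =
  fixes ip :: "'i::finite \<Rightarrow> 'i \<Rightarrow> int"
    and x y t tinv :: "'i \<Rightarrow> 'u::cq_algebra"
    and \<tau> :: "('i \<Rightarrow> int) \<Rightarrow> 'u"
    and \<Delta> :: "'u \<Rightarrow> ('u, 'u) tensor"
    and \<epsilon> :: "'u \<Rightarrow> Cq"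
    and \<sigma> :: "'u \<Rightarrow> 'u"
  assumes presentation: "presented_by (case_generator x y t tinv) (Uq_relations ip)"
    and tau_zero: "\<tau> 0 = 1"
    and tau_add: "\<tau> (c + d) = \<tau> c * \<tau> d"
    and tau_simple: "\<tau> (simple_root i) = t i"
    and tau_bij: "bij_betw \<tau> UNIV (torus t tinv)"
    and hopf: "hopf_algebra \<Delta> \<epsilon> \<sigma>"
    and comult_T: "a \<in> torus t tinv \<Longrightarrow> \<Delta> a = a \<otimes> a"
    and comult_x: "\<Delta> (x i) = x i \<otimes> 1 + t i \<otimes> x i"
    and comult_y: "\<Delta> (y i) = y i \<otimes> tinv i + 1 \<otimes> y i"
    and counit_T: "a \<in> torus t tinv \<Longrightarrow> \<epsilon> a = 1"
    and counit_x: "\<epsilon> (x i) = 0"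
    and counit_y: "\<epsilon> (y i) = 0"
    and antipode_T: "a \<in> torus t tinv \<Longrightarrow> \<sigma> a * a = 1 \<and> a * \<sigma> a = 1"
    and antipode_x: "\<sigma> (x i) = - (tinv i * x i)"
    and antipode_y: "\<sigma> (y i) = - (y i * t i)"


section \<open>The quantum analog of the fixed subalgebra\<close>

definition divided_power :: "Cq \<Rightarrow> nat \<Rightarrow> 'u::cq_algebra \<Rightarrow> 'u"
  where "divided_power v m a = inverse (qfact v m) *\<^sub>q a ^ m"

(* (ad_r x_i1^(m1) ... x_ir^(mr)) is the composite operator
   (ad_r x_i1^(m1)) o ... o (ad_r x_ir^(mr)), as for ad_word. It is not ad_r of the product of the
   divided powers: ad_r is a right action and would compose them in the opposite order. *)
definition ad_r_word ::
    "('i \<Rightarrow> 'i \<Rightarrow> int) \<Rightarrow> ('i \<Rightarrow> 'u) \<Rightarrow> ('u::cq_algebra \<Rightarrow> ('u, 'u) tensor) \<Rightarrow> ('u \<Rightarrow> 'u) \<Rightarrow>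
      ('i \<times> nat) list \<Rightarrow> 'u \<Rightarrow> 'u"
  where "ad_r_word ip x \<Delta> \<sigma> w b =
    foldr (\<lambda>(j, m). ad_r \<Delta> \<sigma> (divided_power (q_of ip j) m (x j))) w b"

locale quantum_symmetric_pair =
  symmetric_pair_data scale br H \<alpha> E ip \<theta> p pi_star w +
  quantized_enveloping_algebra ip x y t tinv \<tau> \<Delta> \<epsilon> \<sigma>
  for scale :: "complex \<Rightarrow> 'g::ab_group_add \<Rightarrow> 'g" and br :: "'g \<Rightarrow> 'g \<Rightarrow> 'g"
    and H :: "'g set" and \<alpha> :: "'i::finite \<Rightarrow> 'g \<Rightarrow> complex"
    and E :: "('i \<Rightarrow> int) \<Rightarrow> 'g" and ip :: "'i \<Rightarrow> 'i \<Rightarrow> int" and \<theta> :: "'g \<Rightarrow> 'g"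
    and p :: "'i \<Rightarrow> 'i" and pi_star :: "'i set" and w :: "'i \<Rightarrow> ('i \<times> nat) list"
    and x y t tinv :: "'i \<Rightarrow> 'u::cq_algebra" and \<tau> :: "('i \<Rightarrow> int) \<Rightarrow> 'u"
    and \<Delta> :: "'u \<Rightarrow> ('u, 'u) tensor" and \<epsilon> :: "'u \<Rightarrow> Cq" and \<sigma> :: "'u \<Rightarrow> 'u" +
  fixes \<theta>t :: "'u \<Rightarrow> 'u"
  assumes theta_tilde: "complex_algebra_automorphism \<theta>t"
    and theta_tilde_y: "i \<in> pi_star \<Longrightarrow>
      \<theta>t (y i) = ad_r_word ip x \<Delta> \<sigma> (w i) (tinv (p i) * x (p i))"
    and theta_tilde_y_p: "i \<in> pi_star \<Longrightarrow>
      \<theta>t (y (p i)) = (- 1) ^ sum_list (map snd (w i)) *\<^sub>q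
        ad_r_word ip x \<Delta> \<sigma> (rev (w i)) (tinv i * x i)"

definition levi_subalgebra ::
    "'i set \<Rightarrow> ('i \<Rightarrow> 'u::cq_algebra) \<Rightarrow> ('i \<Rightarrow> 'u) \<Rightarrow> ('i \<Rightarrow> 'u) \<Rightarrow> ('i \<Rightarrow> 'u) \<Rightarrow> 'u set"
  where "levi_subalgebra S x y t tinv = cq_subalgebra hull (x ` S \<union> y ` S \<union> t ` S \<union> tinv ` S)"

definition T_Theta ::
    "'g set \<Rightarrow> ('i::finite \<Rightarrow> 'g \<Rightarrow> complex) \<Rightarrow> ('g \<Rightarrow> 'g) \<Rightarrow> (('i \<Rightarrow> int) \<Rightarrow> 'u) \<Rightarrow> 'u set"
  where "T_Theta H \<alpha> \<theta> \<tau> = {\<tau> c | c. Theta H \<alpha> \<theta> c = c}"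

definition coideal_B ::
    "'i set \<Rightarrow> ('i \<Rightarrow> 'u) \<Rightarrow> ('i \<Rightarrow> 'u) \<Rightarrow> ('i \<Rightarrow> 'u) \<Rightarrow> ('i \<Rightarrow> 'u) \<Rightarrow> 'u set \<Rightarrow>
      ('u \<Rightarrow> 'u) \<Rightarrow> 'u::cq_algebra set"
  where "coideal_B S x y t tinv TT \<theta>t = cq_subalgebra hull
    (levi_subalgebra S x y t tinv \<union> TT \<union> {y i * t i + \<theta>t (y i) * t i | i. i \<notin> S})"

end

(* Antipode uniqueness gives (ad_r x_j) b = t_j^-1 (b x_j - x_j b) and (ad_r x_j^m) = (ad_r x_j)^m.
   Hence every v in the orbit of t_k^-1 x_k under the operators ad_r x_j with alpha_j in pi_Theta
   satisfies Delta(v) - 1 (x) v in U (x) M t_k^-1, by induction on the word. For v = theta~(y_i)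
   one has k = p(i), or i = p(k), so t_k^-1 t_i lies in T_Theta because Theta fixes
   alpha_i - alpha_p(i); multiplying by t_i (x) t_i gives Delta(B_i) in t_i (x) B_i + U (x) B. *)
theory Submission
  imports Defs
begin

section \<open>Linear maps\<close>

text \<open>\<open>hopf_algebra\<close> does not postulate that the antipode reverses products, so
  the value of \<open>\<sigma>\<close> on powers of \<open>x j\<close> has to be derived. It
  suffices to know \<open>\<sigma> (u * t)\<close> and \<open>\<sigma> (u * x)\<close> for t
  grouplike and x skew primitive over t: as functions of u, both solve a convolution equation whose
  only solution is a left multiple of \<open>\<sigma>\<close>. The coset M t_k^-1 can hold the error
  terms because it absorbs left factors from M and right factors x_j, the latter since t_k^-1 and
  x_j commute up to a scalar. A separate obstacle is \<open>Theta\<close>, a definite description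
  over integer coordinates: it can be used only once \<alpha>_i \<circ> \<theta> is known to be an
  integral combination of simple roots, which is read off from the weight of \<theta>(e_i).\<close>

interpretation cq: vector_space "scaleCq :: Cq \<Rightarrow> 'a \<Rightarrow> 'a::cq_algebra"
  by standard
    (simp_all add: scaleCq_right_distrib scaleCq_left_distrib scaleCq_scaleCq scaleCq_one)

lemma cq_linear_zero: "cq_linear f \<Longrightarrow> f 0 = 0"
  unfolding cq_linear_def by (metis cq.scale_zero_left)

lemma cq_linear_add: "cq_linear f \<Longrightarrow> f (a + b) = f a + f b"
  by (simp add: cq_linear_def)

lemma cq_linear_scale: "cq_linear f \<Longrightarrow> f (c *\<^sub>q a) = c *\<^sub>q f a"
  by (simp add: cq_linear_def)

lemma cq_linear_minus: "cq_linear f \<Longrightarrow> f (- a) = - f a"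
  by (metis cq_linear_scale cq.scale_minus_left scaleCq_one)

lemma cq_linear_diff: "cq_linear f \<Longrightarrow> f (a - b) = f a - f b"
  using cq_linear_add[of f a "- b"] by (simp add: cq_linear_minus)

lemma cq_linear_compose: "cq_linear f \<Longrightarrow> cq_linear g \<Longrightarrow> cq_linear (\<lambda>a. f (g a))"
  by (simp add: cq_linear_def)

lemma cq_linear_mult_left: "cq_linear f \<Longrightarrow> cq_linear (\<lambda>a. c * f a)"
  by (simp add: cq_linear_def distrib_left scaleCq_mult_right)

lemma cq_linear_mult_right: "cq_linear f \<Longrightarrow> cq_linear (\<lambda>a. f a * c)"
  by (simp add: cq_linear_def distrib_right scaleCq_mult_left)

lemma cq_linear_id: "cq_linear (\<lambda>a. a)"
  by (simp add: cq_linear_def)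

text \<open>Common form of \<open>feval\<close> and of \<open>tensor_lift\<close> at a
  representative, so that additivity over changing supports is proved once for both.\<close>

definition linear_extension :: "('k \<Rightarrow> 'a::cq_algebra) \<Rightarrow> ('k \<Rightarrow>\<^sub>0 Cq) \<Rightarrow> 'a"
  where "linear_extension g r =
    (\<Sum>k\<in>Poly_Mapping.keys r. Poly_Mapping.lookup r k *\<^sub>q g k)"

text \<open>Coefficients outside \<open>keys\<close> vanish, so mappings with different supports can
  be summed over one common index set.\<close>

lemma linear_extension_superset:
  assumes "finite K" "Poly_Mapping.keys r \<subseteq> K"
  shows "linear_extension g r = (\<Sum>k\<in>K. Poly_Mapping.lookup r k *\<^sub>q g k)"
  unfolding linear_extension_def
  by (rule sum.mono_neutral_left) (use assms in \<open>auto simp: in_keys_iff\<close>)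

lemma linear_extension_add:
  "linear_extension g (r + s) = linear_extension g r + linear_extension g s"
  by (simp add: linear_extension_superset[of "Poly_Mapping.keys r \<union> Poly_Mapping.keys s"]
      keys_add lookup_add scaleCq_left_distrib sum.distrib)

lemma linear_extension_zero: "linear_extension g 0 = 0"
  by (simp add: linear_extension_def)

lemma linear_extension_single: "linear_extension g (Poly_Mapping.single k c) = c *\<^sub>q g k"
  by (simp add: linear_extension_superset[of "{k}"])

lemma linear_extension_diff:
  "linear_extension g (r - s) = linear_extension g r - linear_extension g s"
  by (metis add_diff_cancel_right' diff_add_cancel linear_extension_add)


section \<open>Tensor products\<close>

definition bilinear :: "('a::cq_algebra \<Rightarrow> 'b::cq_algebra \<Rightarrow> 'c::cq_algebra) \<Rightarrow> bool"
  where "bilinear f \<longleftrightarrow> (\<forall>a. cq_linear (f a)) \<and> (\<forall>b. cq_linear (\<lambda>a. f a b))"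

lemma bilinearI:
  "(\<And>a. cq_linear (f a)) \<Longrightarrow> (\<And>b. cq_linear (\<lambda>a. f a b)) \<Longrightarrow> bilinear f"
  by (simp add: bilinear_def)

lemma bilinear_mult:
  assumes "cq_linear F" "cq_linear G"
  shows "bilinear (\<lambda>a b. F a * G b)"
  using assms by (simp add: bilinear_def cq_linear_mult_left cq_linear_mult_right)

lemma poly_mapping_induct_single [case_names zero add]:
  assumes "P 0" "\<And>k c r. P r \<Longrightarrow> P (Poly_Mapping.single k c + r)"
  shows "P r"
proof (induction r rule: update_induct)
  case (update r k c)
  have "Poly_Mapping.update k c r = Poly_Mapping.single k c + r"
    using update.hyps
    by (intro poly_mapping_eqI) (auto simp: lookup_update lookup_add lookup_single in_keys_iff)
  then show ?case using assms(2) update.IH by simp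
qed (rule assms(1))

section \<open>Pure tensors and linear maps out of a tensor product\<close>

lemma tens_add_left: "(a + a') \<otimes> b = a \<otimes> b + a' \<otimes> b"
  by transfer (use tensor_null.add_left in \<open>simp add: tensor_rel_def diff_diff_eq\<close>)

lemma tens_add_right: "a \<otimes> (b + b') = a \<otimes> b + a \<otimes> b'"
  by transfer (use tensor_null.add_right in \<open>simp add: tensor_rel_def diff_diff_eq\<close>)

lemma abs_tensor_single: "abs_tensor (Poly_Mapping.single (MPair a b) c) = c *\<^sub>q (a \<otimes> b)"
  by (simp add: scaleCq_tensor_def tens.abs_eq times_tensor.abs_eq mult_single
      zero_mpair_def plus_mpair_def)

lemma tens_scale_left: "(d *\<^sub>q a) \<otimes> b = d *\<^sub>q (a \<otimes> b)"
proof -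
  have "tensor_rel (Poly_Mapping.single (MPair (d *\<^sub>q a) b) 1) (Poly_Mapping.single (MPair a b) d)"
    using tensor_null.scale_left[of d a b 1] by (simp add: tensor_rel_def)
  then show ?thesis
    by (metis tensor.abs_eq_iff abs_tensor_single scaleCq_one)
qed

lemma tens_scale_right: "a \<otimes> (d *\<^sub>q b) = d *\<^sub>q (a \<otimes> b)"
proof -
  have "tensor_rel (Poly_Mapping.single (MPair a (d *\<^sub>q b)) 1) (Poly_Mapping.single (MPair a b) d)"
    using tensor_null.scale_right[of a d b 1] by (simp add: tensor_rel_def)
  then show ?thesis
    by (metis tensor.abs_eq_iff abs_tensor_single scaleCq_one)
qed

lemma tens_mult: "(a \<otimes> b) * (a' \<otimes> b') = (a * a') \<otimes> (b * b')"
  by transfer (simp add: tensor_rel_refl mult_single plus_mpair_def)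

lemma tens_one: "1 \<otimes> 1 = 1"
  by transfer (metis single_one tensor_rel_refl zero_mpair_def)

lemma cq_linear_tens_left: "cq_linear f \<Longrightarrow> cq_linear (\<lambda>a. f a \<otimes> b)"
  by (simp add: cq_linear_def tens_add_left tens_scale_left)

lemma cq_linear_tens_right: "cq_linear f \<Longrightarrow> cq_linear (\<lambda>b. a \<otimes> f b)"
  by (simp add: cq_linear_def tens_add_right tens_scale_right)

lemma tens_diff_right: "a \<otimes> (b - b') = a \<otimes> b - a \<otimes> b'"
  by (rule cq_linear_diff) (rule cq_linear_tens_right[OF cq_linear_id])

text \<open>A coefficient can be absorbed into the left factor, so sums of pure tensors without
  scalars already exhaust the tensor product.\<close>

lemma tensor_induct [case_names zero add]:
  assumes zero: "P 0" and add: "\<And>a b z. P z \<Longrightarrow> P (a \<otimes> b + z)"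
  shows "P z"
proof (induction z rule: tensor.abs_induct)
  case (1 r)
  show ?case
  proof (induction r rule: poly_mapping_induct_single)
    case zero
    then show ?case using assms(1) by (simp add: zero_tensor.abs_eq)
  next
    case (add k c r)
    obtain a b where "k = MPair a b" by (cases k)
    then show ?case
      using assms(2)[OF add, of "c *\<^sub>q a" b]
      by (simp add: abs_tensor_single tens_scale_left flip: plus_tensor.abs_eq)
  qed
qed

text \<open>Lets identities in Sweedler notation be checked on pure tensors: they are stated for an
  arbitrary tensor z first, and \<open>\<Delta> a\<close> is substituted afterwards.\<close>

lemma cq_linear_tensor_eqI:
  assumes "cq_linear F" "cq_linear G" "\<And>a b. F (a \<otimes> b) = G (a \<otimes> b)"
  shows "F z = G z"
  by (induction z rule: tensor_induct) (simp_all add: assms cq_linear_zero cq_linear_add)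

lemma linear_extension_tensor_null:
  assumes "bilinear f" "r \<in> tensor_null"
  shows "linear_extension (\<lambda>s. case s of MPair a b \<Rightarrow> f a b) r = 0"
  using assms(2) assms(1)
  by induction (auto simp: linear_extension_zero linear_extension_add linear_extension_diff
      linear_extension_single bilinear_def cq_linear_def scaleCq_right_distrib scaleCq_scaleCq)

text \<open>\<open>rep_tensor\<close> picks an uncontrolled representative; it differs from r by an
  element of \<open>tensor_null\<close>, on which the extension of a bilinear map vanishes.\<close>

lemma tensor_lift_abs:
  assumes "bilinear f"
  shows "tensor_lift f (abs_tensor r) = linear_extension (\<lambda>s. case s of MPair a b \<Rightarrow> f a b) r"
proof -
  let ?L = "linear_extension (\<lambda>s. case s of MPair a b \<Rightarrow> f a b)"
  have "tensor_rel (rep_tensor (abs_tensor r)) r"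
    by (metis tensor.abs_eq_iff Quotient3_abs_rep Quotient3_tensor)
  then have "?L (rep_tensor (abs_tensor r) - r) = 0"
    by (simp add: tensor_rel_def linear_extension_tensor_null[OF assms])
  moreover have "tensor_lift f (abs_tensor r) = ?L (rep_tensor (abs_tensor r))"
    unfolding tensor_lift_def linear_extension_def Let_def
    by (rule sum.cong) (auto split: mpair.splits)
  ultimately show ?thesis by (simp add: linear_extension_diff)
qed

lemma tensor_lift_tens: "bilinear f \<Longrightarrow> tensor_lift f (a \<otimes> b) = f a b"
  by (simp add: tens.abs_eq tensor_lift_abs linear_extension_single scaleCq_one)

lemma tensor_lift_add: "bilinear f \<Longrightarrow> tensor_lift f (u + v) = tensor_lift f u + tensor_lift f v"
  by (induction u rule: tensor.abs_induct, induction v rule: tensor.abs_induct)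
    (simp add: plus_tensor.abs_eq tensor_lift_abs linear_extension_add)

lemma cq_linear_tensor_lift:
  assumes "bilinear f"
  shows "cq_linear (tensor_lift f)"
proof -
  have 0: "tensor_lift f 0 = 0"
    by (simp add: zero_tensor.abs_eq tensor_lift_abs[OF assms] linear_extension_zero)
  have "tensor_lift f (c *\<^sub>q z) = c *\<^sub>q tensor_lift f z" for c z
  proof (induction z rule: tensor_induct)
    case zero
    show ?case by (simp add: 0)
  next
    case (add a b z)
    have "tensor_lift f (c *\<^sub>q (a \<otimes> b)) = c *\<^sub>q f a b"
      using assms
      by (simp add: tensor_lift_tens bilinear_def cq_linear_def flip: tens_scale_left)
    then show ?case
      using add by (simp add: scaleCq_right_distrib tensor_lift_add[OF assms] tensor_lift_tens[OF assms])
  qed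
  then show ?thesis by (simp add: cq_linear_def tensor_lift_add[OF assms])
qed

lemma cq_linear_tensor_lift_eq:
  assumes F: "cq_linear F" and f: "bilinear f"
  shows "F (tensor_lift f z) = tensor_lift (\<lambda>a b. F (f a b)) z"
proof -
  have Ff: "bilinear (\<lambda>a b. F (f a b))"
    using assms unfolding bilinear_def by (auto intro: cq_linear_compose)
  show ?thesis
    using cq_linear_compose[OF F cq_linear_tensor_lift[OF f]] cq_linear_tensor_lift[OF Ff]
    by (rule cq_linear_tensor_eqI) (simp add: tensor_lift_tens f Ff)
qed

text \<open>The image of U \<otimes> B in the tensor product, in the form used by
  \<open>left_coideal_subalgebra\<close>. B may be any set, so that cosets such as
  \<open>levi_coset\<close> are covered as well as subalgebras.\<close>

definition tensor_sub :: "'b::cq_algebra set \<Rightarrow> ('a::cq_algebra, 'b) tensor set"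
  where "tensor_sub B = cq_span {u \<otimes> b | u b. b \<in> B}"

lemma cq_span_eq_span: "cq_span S = cq.span S"
  by (auto simp: cq_span_def cq.span_explicit)

lemma tensor_sub_tens: "b \<in> B \<Longrightarrow> u \<otimes> b \<in> tensor_sub B"
  unfolding tensor_sub_def cq_span_eq_span by (rule cq.span_base) auto

lemma tensor_sub_add: "z \<in> tensor_sub B \<Longrightarrow> z' \<in> tensor_sub B \<Longrightarrow> z + z' \<in> tensor_sub B"
  unfolding tensor_sub_def cq_span_eq_span by (rule cq.span_add)

lemma tensor_sub_diff: "z \<in> tensor_sub B \<Longrightarrow> z' \<in> tensor_sub B \<Longrightarrow> z - z' \<in> tensor_sub B"
  unfolding tensor_sub_def cq_span_eq_span by (rule cq.span_diff)

lemma tensor_sub_scale: "z \<in> tensor_sub B \<Longrightarrow> c *\<^sub>q z \<in> tensor_sub B"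
  unfolding tensor_sub_def cq_span_eq_span by (rule cq.span_scale)

lemma tensor_sub_linear:
  assumes "cq_linear F" "\<And>u b. b \<in> B \<Longrightarrow> F (u \<otimes> b) \<in> tensor_sub C" "z \<in> tensor_sub B"
  shows "F z \<in> tensor_sub C"
  using assms(3) unfolding tensor_sub_def cq_span_eq_span
proof (induction rule: cq.span_induct_alt)
  case base
  then show ?case by (simp add: cq_linear_zero[OF assms(1)] cq.span_zero)
next
  case (step c z z')
  then show ?case
    using assms(2) unfolding tensor_sub_def cq_span_eq_span
    by (auto simp: cq_linear_add[OF assms(1)] cq_linear_scale[OF assms(1)]
        intro!: cq.span_add cq.span_scale)
qed

lemma tensor_sub_mult_left:
  assumes "z \<in> tensor_sub B" "\<And>b. b \<in> B \<Longrightarrow> v * b \<in> C"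
  shows "(u \<otimes> v) * z \<in> tensor_sub C"
  by (rule tensor_sub_linear[OF cq_linear_mult_left[OF cq_linear_id] _ assms(1)])
    (simp add: tens_mult tensor_sub_tens assms(2))

lemma tensor_sub_mult_right:
  assumes "z \<in> tensor_sub B" "\<And>b. b \<in> B \<Longrightarrow> b * v \<in> C"
  shows "z * (u \<otimes> v) \<in> tensor_sub C"
  by (rule tensor_sub_linear[OF cq_linear_mult_right[OF cq_linear_id] _ assms(1)])
    (simp add: tens_mult tensor_sub_tens assms(2))

lemma tensor_sub_mult:
  assumes "cq_subalgebra B" "z \<in> tensor_sub B" "z' \<in> tensor_sub B"
  shows "z * z' \<in> tensor_sub B"
proof (rule tensor_sub_linear[OF cq_linear_mult_right[OF cq_linear_id] _ assms(2)])
  fix u b assume "b \<in> B"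
  then show "(u \<otimes> b) * z' \<in> tensor_sub B"
    using assms(1,3) by (intro tensor_sub_mult_left[of z' B]) (auto simp: cq_subalgebra_def)
qed


section \<open>Subalgebras\<close>

lemma cq_subalgebra_hull: "cq_subalgebra (cq_subalgebra hull S)"
  by (rule hull_in) (auto simp: cq_subalgebra_def)

text \<open>U \<otimes> B is closed under products, so its preimage under the homomorphism
  \<open>\<Delta>\<close> is a subalgebra; it contains S and hence the whole hull. The coideal
  property thus needs checking on generators only.\<close>

lemma left_coideal_subalgebra_hull:
  assumes \<Delta>: "cq_alg_hom \<Delta>" and S: "\<And>s. s \<in> S \<Longrightarrow> \<Delta> s \<in> tensor_sub (cq_subalgebra hull S)"
  shows "left_coideal_subalgebra \<Delta> (cq_subalgebra hull S)"
proof -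
  let ?B = "cq_subalgebra hull S"
  have B: "cq_subalgebra ?B" by (rule cq_subalgebra_hull)
  let ?C = "{b. \<Delta> b \<in> tensor_sub ?B}"
  have "1 \<otimes> 1 \<in> tensor_sub ?B"
    using B by (intro tensor_sub_tens) (simp add: cq_subalgebra_def)
  then have "cq_subalgebra ?C"
    using \<Delta> tensor_sub_mult[OF B]
    by (auto simp: cq_subalgebra_def cq_alg_hom_def cq_linear_def tens_one
        tensor_sub_add tensor_sub_scale)
  then have "?B \<subseteq> ?C"
    using S by (intro hull_minimal) auto
  then show ?thesis
    using B by (auto simp: left_coideal_subalgebra_def tensor_sub_def)
qed


section \<open>The antipode\<close>

locale quantum_hopf_algebra =
  fixes \<Delta> :: "'u::cq_algebra \<Rightarrow> ('u, 'u) tensor" and \<epsilon> :: "'u \<Rightarrow> Cq" and \<sigma> :: "'u \<Rightarrow> 'u"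
  assumes hopf_algebra: "hopf_algebra \<Delta> \<epsilon> \<sigma>"
begin

lemma comult_hom: "cq_alg_hom \<Delta>"
  using hopf_algebra by (simp add: hopf_algebra_def)

lemma comult_linear: "cq_linear \<Delta>"
  using comult_hom by (simp add: cq_alg_hom_def)

lemma comult_mult: "\<Delta> (a * b) = \<Delta> a * \<Delta> b"
  using comult_hom by (simp add: cq_alg_hom_def)

lemma antipode_linear: "cq_linear \<sigma>"
  using hopf_algebra by (simp add: hopf_algebra_def)

lemma counit_linear: "cq_linear (\<lambda>a. \<epsilon> a *\<^sub>q b)"
  using hopf_algebra
  by (simp add: hopf_algebra_def cq_linear_def scaleCq_left_distrib scaleCq_scaleCq)

text \<open>Evaluate \<open>G(a\<^sub>1) a\<^sub>2 \<sigma>(a\<^sub>3)\<close> in two ways.\<close>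

lemma convolution_inverse_unique:
  assumes G: "cq_linear G" and conv: "\<And>a. tensor_lift (\<lambda>a' a''. G a' * a'') (\<Delta> a) = \<epsilon> a *\<^sub>q c"
  shows "G u = c * \<sigma> u"
proof -
  define K where "K = tensor_lift (\<lambda>a b. a * \<sigma> b)"
  have biK: "bilinear (\<lambda>a b. a * \<sigma> b)"
    by (rule bilinear_mult[OF cq_linear_id antipode_linear])
  have K: "cq_linear K"
    unfolding K_def by (rule cq_linear_tensor_lift[OF biK])
  have K_tens: "K (a \<otimes> b) = a * \<sigma> b" for a b
    unfolding K_def by (rule tensor_lift_tens[OF biK])
  \<comment> \<open>On \<open>a \<otimes> (b \<otimes> d)\<close> this is
    \<open>G a * (b * \<sigma> d)\<close>; coassociativity is applied underneath it.\<close>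
  define L where "L = tensor_lift (\<lambda>a z. G a * K z)"
  have biL: "bilinear (\<lambda>a z. G a * K z)"
    by (rule bilinear_mult[OF G K])
  have L: "cq_linear L"
    unfolding L_def by (rule cq_linear_tensor_lift[OF biL])
  have L_tens: "L (a \<otimes> z) = G a * K z" for a z
    unfolding L_def by (rule tensor_lift_tens[OF biL])
  have bi1: "bilinear (\<lambda>a' a''. a' \<otimes> (a'' \<otimes> b))" for b :: 'u
    by (simp add: bilinear_def cq_linear_tens_left cq_linear_tens_right cq_linear_id)
  have bi2: "bilinear (\<lambda>a (b :: 'u). tensor_lift (\<lambda>a' a''. a' \<otimes> (a'' \<otimes> b)) (\<Delta> a))"
  proof (rule bilinearI)
    show "cq_linear (\<lambda>a. tensor_lift (\<lambda>a' a''. a' \<otimes> (a'' \<otimes> b)) (\<Delta> a))" for b :: 'u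
      by (rule cq_linear_compose[OF cq_linear_tensor_lift[OF bi1] comult_linear])
    \<comment> \<open>Linearity in b is hidden inside \<open>tensor_lift\<close>, so it is shown for
      a general tensor z by induction before \<open>\<Delta> a\<close> is inserted.\<close>
    define M :: "'u \<Rightarrow> ('u, 'u) tensor \<Rightarrow> ('u, ('u, 'u) tensor) tensor"
      where "M b = tensor_lift (\<lambda>a' a''. a' \<otimes> (a'' \<otimes> b))" for b
    have M: "cq_linear (M b)" "M b (a' \<otimes> a'') = a' \<otimes> (a'' \<otimes> b)" for b a' a''
      unfolding M_def by (rule cq_linear_tensor_lift tensor_lift_tens, rule bi1)+
    have "M (b + b') z = M b z + M b' z" "M (k *\<^sub>q b) z = k *\<^sub>q M b z" for b b' k z
      by (induction z rule: tensor_induct)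
        (simp_all add: M(2) cq_linear_zero[OF M(1)] cq_linear_add[OF M(1)]
          tens_add_right tens_scale_right scaleCq_right_distrib)
    then show "cq_linear (\<lambda>b :: 'u. tensor_lift (\<lambda>a' a''. a' \<otimes> (a'' \<otimes> b)) (\<Delta> a))" for a
      unfolding M_def by (simp add: cq_linear_def)
  qed
  have bi3: "bilinear (\<lambda>a b. a \<otimes> \<Delta> b)"
    by (simp add: bilinear_def cq_linear_tens_left cq_linear_tens_right cq_linear_id comult_linear)
  have bi4: "bilinear (\<lambda>a b. G a * b)"
    by (rule bilinear_mult[OF G cq_linear_id])
  have bi5: "bilinear (\<lambda>a b. \<epsilon> b *\<^sub>q a)" "bilinear (\<lambda>a b. \<epsilon> a *\<^sub>q b)"
    by (auto simp: bilinear_def counit_linear)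
      (simp_all add: cq_linear_def scaleCq_right_distrib scaleCq_scaleCq mult.commute)
  have "tensor_lift (\<lambda>a b. L (tensor_lift (\<lambda>a' a''. a' \<otimes> (a'' \<otimes> b)) (\<Delta> a))) (\<Delta> u) =
      tensor_lift (\<lambda>a b. L (a \<otimes> \<Delta> b)) (\<Delta> u)"
    using hopf_algebra
    by (simp add: hopf_algebra_def cq_linear_tensor_lift_eq[OF L bi2, symmetric]
        cq_linear_tensor_lift_eq[OF L bi3, symmetric])
  \<comment> \<open>Right bracketing: the antipode axiom collapses the last two factors to a
    counit.\<close>
  moreover have "L (a \<otimes> \<Delta> b) = G (\<epsilon> b *\<^sub>q a)" for a b
  proof -
    have "K (\<Delta> b) = \<epsilon> b *\<^sub>q 1"
      using hopf_algebra by (simp add: hopf_algebra_def K_def)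
    then show ?thesis
      by (simp add: L_tens cq_linear_scale[OF G] scaleCq_mult_right)
  qed
  \<comment> \<open>Left bracketing: \<open>conv\<close> collapses the first two factors. The counit
    axioms then remove the remaining coproduct on both sides.\<close>
  moreover have "L (tensor_lift (\<lambda>a' a''. a' \<otimes> (a'' \<otimes> b)) (\<Delta> a)) = c * \<sigma> (\<epsilon> a *\<^sub>q b)" for a b
  proof -
    have "L (tensor_lift (\<lambda>a' a''. a' \<otimes> (a'' \<otimes> b)) (\<Delta> a)) =
        tensor_lift (\<lambda>a' a''. (G a' * a'') * \<sigma> b) (\<Delta> a)"
      by (simp add: cq_linear_tensor_lift_eq[OF L bi1] L_tens K_tens mult.assoc)
    also have "\<dots> = (\<epsilon> a *\<^sub>q c) * \<sigma> b"
      by (simp add: conv[symmetric]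
          cq_linear_tensor_lift_eq[OF cq_linear_mult_right[OF cq_linear_id] bi4])
    finally show ?thesis
      by (simp add: cq_linear_scale[OF antipode_linear] scaleCq_mult_left scaleCq_mult_right)
  qed
  ultimately have "tensor_lift (\<lambda>a b. c * \<sigma> (\<epsilon> a *\<^sub>q b)) (\<Delta> u) =
      tensor_lift (\<lambda>a b. G (\<epsilon> b *\<^sub>q a)) (\<Delta> u)"
    by simp
  then have "c * \<sigma> (tensor_lift (\<lambda>a b. \<epsilon> a *\<^sub>q b) (\<Delta> u)) =
      G (tensor_lift (\<lambda>a b. \<epsilon> b *\<^sub>q a) (\<Delta> u))"
    by (simp add: cq_linear_tensor_lift_eq[OF G bi5(1)]
        cq_linear_tensor_lift_eq[OF cq_linear_mult_left[OF antipode_linear] bi5(2)])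
  then show ?thesis
    using hopf_algebra by (simp add: hopf_algebra_def)
qed

text \<open>Inserting \<open>t * s = 1\<close> on the right turns the sum of \<sigma>(a_1 t) a_2
  into the antipode sum of \<open>a * t\<close> times s, which is \<epsilon>(a) s. Convolution
  uniqueness applies with c = s.\<close>

lemma antipode_mult_grouplike:
  assumes "\<Delta> t = t \<otimes> t" "\<epsilon> t = 1" "t * s = 1"
  shows "\<sigma> (u * t) = s * \<sigma> u"
proof (rule convolution_inverse_unique)
  show G: "cq_linear (\<lambda>u. \<sigma> (u * t))"
    by (rule cq_linear_compose[OF antipode_linear cq_linear_mult_right[OF cq_linear_id]])
  fix a
  have bi: "bilinear (\<lambda>a b. \<sigma> (a * t) * b)" "bilinear (\<lambda>a b. \<sigma> a * b)"
    by (rule bilinear_mult[OF G cq_linear_id] bilinear_mult[OF antipode_linear cq_linear_id])+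
  have "tensor_lift (\<lambda>a b. \<sigma> (a * t) * b) z = tensor_lift (\<lambda>a b. \<sigma> a * b) (z * (t \<otimes> t)) * s" for z
    by (rule cq_linear_tensor_eqI[OF cq_linear_tensor_lift[OF bi(1)] cq_linear_mult_right[OF
            cq_linear_compose[OF cq_linear_tensor_lift[OF bi(2)] cq_linear_mult_right[OF cq_linear_id]]]])
      (simp add: tensor_lift_tens bi tens_mult mult.assoc assms(3))
  then have "tensor_lift (\<lambda>a b. \<sigma> (a * t) * b) (\<Delta> a) =
      tensor_lift (\<lambda>a b. \<sigma> a * b) (\<Delta> (a * t)) * s"
    by (simp add: comult_mult assms(1))
  then show "tensor_lift (\<lambda>a b. \<sigma> (a * t) * b) (\<Delta> a) = \<epsilon> a *\<^sub>q s"
    using hopf_algebra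
    by (simp add: hopf_algebra_def assms(2) scaleCq_mult_left)
qed

text \<open>The antipode sum of \<open>a * x\<close> is \<epsilon>(a x) = 0. Expanded, it is the sum
  of \<sigma>(a_1 x) a_2 plus that of \<sigma>(a_1 t) a_2 x, and the grouplike case evaluates the
  latter to \<epsilon>(a) s x. Convolution uniqueness applies with c = -(s x).\<close>

lemma antipode_mult_skew_primitive:
  assumes t: "\<Delta> t = t \<otimes> t" "\<epsilon> t = 1" "t * s = 1"
    and x: "\<Delta> x = x \<otimes> 1 + t \<otimes> x" "\<epsilon> x = 0"
  shows "\<sigma> (u * x) = - (s * x) * \<sigma> u"
proof (rule convolution_inverse_unique)
  show G: "cq_linear (\<lambda>u. \<sigma> (u * x))"
    by (rule cq_linear_compose[OF antipode_linear cq_linear_mult_right[OF cq_linear_id]])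
  fix a
  have bi: "bilinear (\<lambda>a b. \<sigma> (a * x) * b)" "bilinear (\<lambda>a b. \<sigma> a * b)"
    by (rule bilinear_mult[OF G cq_linear_id] bilinear_mult[OF antipode_linear cq_linear_id])+
  let ?m = "tensor_lift (\<lambda>a b. \<sigma> a * b)"
  note lin = cq_linear_tensor_lift[OF bi(2)]
  have lin': "cq_linear (\<lambda>z. ?m (z * (x \<otimes> 1 + t \<otimes> x)))" "cq_linear (\<lambda>z. s * ?m z * x)"
    by (rule cq_linear_compose[OF lin cq_linear_mult_right[OF cq_linear_id]]
        cq_linear_mult_right[OF cq_linear_mult_left[OF lin]])+
  have "tensor_lift (\<lambda>a b. \<sigma> (a * x) * b) z = ?m (z * (x \<otimes> 1 + t \<otimes> x)) - s * ?m z * x" for z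
  proof (rule cq_linear_tensor_eqI[OF cq_linear_tensor_lift[OF bi(1)]])
    show "cq_linear (\<lambda>z. ?m (z * (x \<otimes> 1 + t \<otimes> x)) - s * ?m z * x)"
      using lin' by (simp add: cq_linear_def cq.scale_right_diff_distrib)
    show "tensor_lift (\<lambda>a b. \<sigma> (a * x) * b) (a \<otimes> b) =
        ?m ((a \<otimes> b) * (x \<otimes> 1 + t \<otimes> x)) - s * ?m (a \<otimes> b) * x" for a b
      by (simp add: tensor_lift_tens bi tens_mult distrib_left tensor_lift_add
          antipode_mult_grouplike[OF t] mult.assoc)
  qed
  then have "tensor_lift (\<lambda>a b. \<sigma> (a * x) * b) (\<Delta> a) = ?m (\<Delta> (a * x)) - s * ?m (\<Delta> a) * x"
    by (simp add: comult_mult x(1))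
  then show "tensor_lift (\<lambda>a b. \<sigma> (a * x) * b) (\<Delta> a) = \<epsilon> a *\<^sub>q - (s * x)"
    using hopf_algebra
    by (simp add: hopf_algebra_def x(2) scaleCq_mult_left scaleCq_mult_right)
qed

section \<open>The right adjoint action as a twisted commutator\<close>

lemma ad_r_linear: "cq_linear (\<lambda>a. ad_r \<Delta> \<sigma> a b)"
  unfolding ad_r_def
  by (rule cq_linear_compose[OF cq_linear_tensor_lift[OF bilinear_mult[OF
            cq_linear_mult_right[OF antipode_linear] cq_linear_id]] comult_linear])

text \<open>In \<open>\<Delta> u * (x \<otimes> 1 + t \<otimes> x)\<close> the first summand
  contributes the term with x on the left, via \<sigma>(u_1 x), and the second the term with x on
  the right. Since the action is a right action, the factor x acts after u.\<close>

lemma ad_r_mult_skew_primitive: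
  assumes t: "\<Delta> t = t \<otimes> t" "\<epsilon> t = 1" "t * s = 1"
    and x: "\<Delta> x = x \<otimes> 1 + t \<otimes> x" "\<epsilon> x = 0"
  shows "ad_r \<Delta> \<sigma> (u * x) b = s * (ad_r \<Delta> \<sigma> u b * x - x * ad_r \<Delta> \<sigma> u b)"
proof -
  have bi: "bilinear (\<lambda>a' a''. \<sigma> a' * b * a'')"
    by (rule bilinear_mult[OF cq_linear_mult_right[OF antipode_linear] cq_linear_id])
  let ?m = "tensor_lift (\<lambda>a' a''. \<sigma> a' * b * a'')"
  note lin = cq_linear_tensor_lift[OF bi]
  have "?m (z * (x \<otimes> 1 + t \<otimes> x)) = s * (?m z * x - x * ?m z)" for z
  proof (rule cq_linear_tensor_eqI)
    show "cq_linear (\<lambda>z. ?m (z * (x \<otimes> 1 + t \<otimes> x)))"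
      by (rule cq_linear_compose[OF lin cq_linear_mult_right[OF cq_linear_id]])
    show "cq_linear (\<lambda>z. s * (?m z * x - x * ?m z))"
      using lin by (intro cq_linear_mult_left)
        (simp add: cq_linear_def cq.scale_right_diff_distrib algebra_simps scaleCq_mult_left scaleCq_mult_right)
    show "?m ((a \<otimes> c) * (x \<otimes> 1 + t \<otimes> x)) = s * (?m (a \<otimes> c) * x - x * ?m (a \<otimes> c))" for a c
      by (simp only: tensor_lift_tens[OF bi] tens_mult distrib_left tensor_lift_add[OF bi]
          antipode_mult_grouplike[OF t] antipode_mult_skew_primitive[OF t x])
        (simp add: right_diff_distrib mult.assoc)
  qed
  then show ?thesis by (simp add: ad_r_def comult_mult x(1))
qed

lemma ad_r_power_skew_primitive:
  assumes t: "\<Delta> t = t \<otimes> t" "\<epsilon> t = 1" "t * s = 1"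
    and x: "\<Delta> x = x \<otimes> 1 + t \<otimes> x" "\<epsilon> x = 0"
    and one: "\<sigma> 1 = 1"
  shows "ad_r \<Delta> \<sigma> (x ^ m) b = ((\<lambda>v. s * (v * x - x * v)) ^^ m) b"
proof (induction m)
  case 0
  have "bilinear (\<lambda>a' a''. \<sigma> a' * b * a'')"
    by (rule bilinear_mult[OF cq_linear_mult_right[OF antipode_linear] cq_linear_id])
  then show ?case
    using comult_hom
    by (simp add: ad_r_def cq_alg_hom_def one tensor_lift_tens flip: tens_one)
next
  \<comment> \<open>\<open>power_Suc2\<close> splits the power as \<open>x ^ m * x\<close>, so that
    the outermost commutator comes from the rightmost factor.\<close>
  case (Suc m)
  then show ?case
    by (simp add: ad_r_mult_skew_primitive[OF t x] power_Suc2 del: power_Suc)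
qed

end


section \<open>Relations in the quantized enveloping algebra\<close>

lemma feval_eq_linear_extension:
  "feval \<phi> r = linear_extension (\<lambda>v. case v of Word xs \<Rightarrow> prod_list (map \<phi> xs)) r"
  unfolding feval_def linear_extension_def by (rule sum.cong) (auto split: fword.splits)

lemma feval_diff: "feval \<phi> (r - s) = feval \<phi> r - feval \<phi> s"
  by (simp add: feval_eq_linear_extension linear_extension_diff)

lemma feval_single: "feval \<phi> (Poly_Mapping.single (Word xs) c) = c *\<^sub>q prod_list (map \<phi> xs)"
  by (simp add: feval_eq_linear_extension linear_extension_single)

lemma feval_one: "feval \<phi> 1 = 1"
  using feval_single[of \<phi> "[]" 1] by (simp add: scaleCq_one flip: zero_fword_def)

lemma feval_monomial2:
  "feval \<phi> (fgen a * fgen b) = \<phi> a * \<phi> b"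
  "feval \<phi> (fconst c * fgen a * fgen b) = c *\<^sub>q (\<phi> a * \<phi> b)"
  by (simp_all add: fgen_def fconst_def mult_single plus_fword_def zero_fword_def feval_single
      scaleCq_one)

lemma presented_by_relation: "presented_by \<phi> R \<Longrightarrow> r \<in> R \<Longrightarrow> feval \<phi> r = 0"
  using hull_inc[of r R two_sided_ideal] by (auto simp: presented_by_def)

lemma qq_nonzero: "qq \<noteq> 0"
  by (simp add: qq_def Zero_fract_def eq_fract)

context quantized_enveloping_algebra
begin

sublocale quantum_hopf_algebra \<Delta> \<epsilon> \<sigma>
  by standard (rule hopf)

lemma t_tinv: "t i * tinv i = 1" and tinv_t: "tinv i * t i = 1"
proof -
  have "fgen (GT i) * fgen (GTinv i) - 1 \<in> Uq_relations ip"
    "fgen (GTinv i) * fgen (GT i) - 1 \<in> Uq_relations ip"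
    unfolding Uq_relations_def by blast+
  from this[THEN presented_by_relation[OF presentation]]
  show "t i * tinv i = 1" "tinv i * t i = 1"
    by (simp_all add: feval_diff feval_monomial2 feval_one)
qed

lemma t_x: "t i * x j = qq powi ip i j *\<^sub>q (x j * t i)"
proof -
  have "fgen (GT i) * fgen (GX j) - fconst (qq powi ip i j) * fgen (GX j) * fgen (GT i)
      \<in> Uq_relations ip"
    unfolding Uq_relations_def by blast
  from presented_by_relation[OF presentation this] show ?thesis
    by (simp add: feval_diff feval_monomial2)
qed

lemma tau_uminus: "\<tau> (- simple_root i) = tinv i"
proof -
  have "\<tau> (- simple_root i) * t i = 1"
    using tau_add[of "- simple_root i" "simple_root i"] by (simp add: tau_zero tau_simple)
  then show ?thesis
    by (metis mult.assoc mult_1_left mult_1_right t_tinv)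
qed

text \<open>Conjugate \<open>t_x\<close> by \<open>tinv i\<close>. This scalar commutation makes the
  cosets M t_k^-1 stable under right multiplication by x_j.\<close>

lemma tinv_x_commute: "tinv i * x j = inverse (qq powi ip i j) *\<^sub>q (x j * tinv i)"
proof -
  have "x j * tinv i = tinv i * (t i * x j) * tinv i"
    by (simp add: tinv_t flip: mult.assoc)
  also have "\<dots> = qq powi ip i j *\<^sub>q (tinv i * x j)"
    by (simp add: t_x scaleCq_mult_left scaleCq_mult_right mult.assoc t_tinv)
  finally show ?thesis
    by (simp add: scaleCq_scaleCq scaleCq_one qq_nonzero)
qed

lemma grouplike:
  "\<Delta> (t i) = t i \<otimes> t i" "\<Delta> (tinv i) = tinv i \<otimes> tinv i" "\<epsilon> (t i) = 1"
proof -
  have "t i \<in> torus t tinv" "tinv i \<in> torus t tinv"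
    unfolding torus_def by (auto intro: hull_inc)
  then show "\<Delta> (t i) = t i \<otimes> t i" "\<Delta> (tinv i) = tinv i \<otimes> tinv i" "\<epsilon> (t i) = 1"
    by (simp_all add: comult_T counit_T)
qed

lemma tau_torus: "\<tau> c \<in> torus t tinv"
  using tau_bij by (auto simp: bij_betw_def)

lemma antipode_one: "\<sigma> 1 = 1"
  using antipode_T[OF tau_torus[of 0]] by (simp add: tau_zero)

lemma ad_r_divided_power:
  "ad_r \<Delta> \<sigma> (divided_power v m (x j)) b =
    inverse (qfact v m) *\<^sub>q ((\<lambda>a. tinv j * (a * x j - x j * a)) ^^ m) b"
  unfolding divided_power_def
  by (simp add: cq_linear_scale[OF ad_r_linear] ad_r_power_skew_primitive[OF grouplike(1,3)
        t_tinv comult_x counit_x antipode_one])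

section \<open>The subalgebra M and its cosets\<close>

abbreviation levi_quantum :: "'i set \<Rightarrow> 'u set"
  where "levi_quantum S \<equiv> levi_subalgebra S x y t tinv"

lemma levi_subalgebra: "cq_subalgebra (levi_quantum S)"
  unfolding levi_subalgebra_def by (rule cq_subalgebra_hull)

lemma levi_generators:
  assumes "i \<in> S"
  shows "x i \<in> levi_quantum S" "y i \<in> levi_quantum S" "t i \<in> levi_quantum S" "tinv i \<in> levi_quantum S"
  using assms unfolding levi_subalgebra_def by (auto intro: hull_inc)

lemma levi_closed:
  "1 \<in> levi_quantum S"
  "a \<in> levi_quantum S \<Longrightarrow> b \<in> levi_quantum S \<Longrightarrow> a * b \<in> levi_quantum S"
  "a \<in> levi_quantum S \<Longrightarrow> c *\<^sub>q a \<in> levi_quantum S"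
  using levi_subalgebra[of S] by (auto simp: cq_subalgebra_def)

text \<open>The coproduct of each generator of M has all its right tensor factors in M, so the hull
  criterion applies to M itself.\<close>

lemma comult_levi: "m \<in> levi_quantum S \<Longrightarrow> \<Delta> m \<in> tensor_sub (levi_quantum S)"
proof -
  have "left_coideal_subalgebra \<Delta> (levi_quantum S)"
    unfolding levi_subalgebra_def
  proof (rule left_coideal_subalgebra_hull[OF comult_hom], fold levi_subalgebra_def)
    fix s assume "s \<in> x ` S \<union> y ` S \<union> t ` S \<union> tinv ` S"
    then show "\<Delta> s \<in> tensor_sub (levi_quantum S)"
      by (auto simp: grouplike comult_x comult_y
          intro!: tensor_sub_add tensor_sub_tens levi_generators levi_closed)
  qed
  then show "m \<in> levi_quantum S \<Longrightarrow> \<Delta> m \<in> tensor_sub (levi_quantum S)"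
    by (auto simp: left_coideal_subalgebra_def tensor_sub_def)
qed

text \<open>The shift by \<open>tinv k\<close> comes from the starting vector, as the error term of
  \<open>\<Delta> (tinv k * x k)\<close> is \<open>(tinv k * x k) \<otimes> tinv k\<close>.
  Multiplying by \<open>t i\<close> later moves the coset into B when \<open>tinv k * t i\<close>
  lies in B.\<close>

definition levi_coset :: "'i set \<Rightarrow> 'i \<Rightarrow> 'u set"
  where "levi_coset S k = (\<lambda>m. m * tinv k) ` levi_quantum S"

lemma levi_cosetI: "m \<in> levi_quantum S \<Longrightarrow> m * tinv k \<in> levi_coset S k"
  unfolding levi_coset_def by (rule imageI)

lemma levi_coset_mult_left:
  assumes "a \<in> levi_quantum S" "b \<in> levi_coset S k"
  shows "a * b \<in> levi_coset S k"
  using assms levi_cosetI[OF levi_closed(2)[OF assms(1)]]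
  by (auto simp: levi_coset_def[of S] mult.assoc)

lemma levi_coset_mult_x:
  assumes "j \<in> S" "b \<in> levi_coset S k"
  shows "b * x j \<in> levi_coset S k"
proof -
  from assms(2) obtain m where m: "m \<in> levi_quantum S" and b: "b = m * tinv k"
    by (auto simp: levi_coset_def)
  have "b * x j = inverse (qq powi ip k j) *\<^sub>q (m * x j) * tinv k"
    by (simp add: b tinv_x_commute scaleCq_mult_right scaleCq_mult_left mult.assoc)
  then show ?thesis
    using m assms(1) by (simp add: levi_cosetI levi_closed levi_generators)
qed

section \<open>Vectors whose coproduct has leading term 1 \<otimes> v\<close>

definition coideal_vector :: "'i set \<Rightarrow> 'i \<Rightarrow> 'u \<Rightarrow> bool"
  where "coideal_vector S k v \<longleftrightarrow> \<Delta> v - 1 \<otimes> v \<in> tensor_sub (levi_coset S k)"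

lemma coideal_vector_scale: "coideal_vector S k v \<Longrightarrow> coideal_vector S k (c *\<^sub>q v)"
  unfolding coideal_vector_def
  by (drule tensor_sub_scale[of _ _ c])
    (simp add: cq_linear_scale[OF comult_linear] tens_scale_right cq.scale_right_diff_distrib)

lemma coideal_vector_start: "coideal_vector S k (tinv k * x k)"
proof -
  have "\<Delta> (tinv k * x k) - 1 \<otimes> (tinv k * x k) = (tinv k * x k) \<otimes> (1 * tinv k)"
    by (simp add: comult_mult grouplike comult_x distrib_left tens_mult tinv_t)
  also have "\<dots> \<in> tensor_sub (levi_coset S k)"
    by (intro tensor_sub_tens levi_cosetI levi_closed)
  finally show ?thesis by (simp add: coideal_vector_def)
qed

text \<open>\<open>1 \<otimes> v\<close> commutes with the summand \<open>x\<^sub>j \<otimes> 1\<close> of \<open>\<Delta>(x\<^sub>j)\<close>, and its commutator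
  with \<open>t\<^sub>j \<otimes> x\<^sub>j\<close> yields the new leading term.\<close>

lemma coideal_vector_step:
  assumes "j \<in> S" "coideal_vector S k v"
  shows "coideal_vector S k (tinv j * (v * x j - x j * v))"
proof -
  define D where "D = \<Delta> v - 1 \<otimes> v"
  define X where "X = \<Delta> (x j)"
  have X: "X = x j \<otimes> 1 + t j \<otimes> x j" by (simp add: X_def comult_x)
  have D: "D \<in> tensor_sub (levi_coset S k)"
    using assms(2) by (simp add: coideal_vector_def D_def)
  have DX: "D * X \<in> tensor_sub (levi_coset S k)"
    unfolding X distrib_left using assms(1)
    by (intro tensor_sub_add tensor_sub_mult_right[OF D]) (auto intro: levi_coset_mult_x)
  have XD: "X * D \<in> tensor_sub (levi_coset S k)"
    unfolding X distrib_right using assms(1)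
    by (intro tensor_sub_add tensor_sub_mult_left[OF D])
      (auto intro: levi_coset_mult_left levi_generators)
  have "(tinv j \<otimes> tinv j) * (D * X - X * D) \<in> tensor_sub (levi_coset S k)"
    using assms(1)
    by (intro tensor_sub_mult_left[OF tensor_sub_diff[OF DX XD]])
      (auto intro: levi_coset_mult_left levi_generators)
  moreover have "(1 \<otimes> v) * X - X * (1 \<otimes> v) = t j \<otimes> (v * x j - x j * v)"
    by (simp add: X distrib_left distrib_right tens_mult tens_diff_right)
  then have "(tinv j \<otimes> tinv j) * ((1 \<otimes> v) * X - X * (1 \<otimes> v)) =
      1 \<otimes> (tinv j * (v * x j - x j * v))"
    by (simp add: tens_mult tinv_t)
  \<comment> \<open>Expanding \<Delta>(v) as D + 1 \<otimes> v, the commutator of 1 \<otimes> v with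
    X accounts exactly for the subtracted leading term, leaving the commutator of D.\<close>
  then have "\<Delta> (tinv j * (v * x j - x j * v)) - 1 \<otimes> (tinv j * (v * x j - x j * v)) =
      (tinv j \<otimes> tinv j) * (D * X - X * D)"
    by (simp add: comult_mult cq_linear_diff[OF comult_linear] grouplike D_def algebra_simps
        flip: X_def)
  ultimately show ?thesis by (simp add: coideal_vector_def)
qed

text \<open>The assumption constrains only the set of letters, so the result applies to a word and
  to its reversal alike. The scalars of the divided powers are absorbed by
  \<open>coideal_vector_scale\<close>.\<close>

lemma coideal_vector_ad_r_word:
  assumes "fst ` set ws \<subseteq> S"
  shows "coideal_vector S k (ad_r_word ip x \<Delta> \<sigma> ws (tinv k * x k))"
  using assms
proof (induction ws)
  case Nil
  then show ?case by (simp add: ad_r_word_def coideal_vector_start)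
next
  case (Cons a ws)
  obtain j m where a: "a = (j, m)" by (cases a)
  have "coideal_vector S k (((\<lambda>a. tinv j * (a * x j - x j * a)) ^^ m) v)"
    if "coideal_vector S k v" for v
    using that Cons.prems by (induction m) (auto simp: a coideal_vector_step)
  then show ?case
    using Cons by (simp add: ad_r_word_def a ad_r_divided_power coideal_vector_scale)
qed

text \<open>Neither \<open>y i * t i\<close> nor \<open>v * t i\<close> is assumed to lie in B, but
  both coproducts have a leading term with left factor \<open>t i\<close>, and these add up to
  \<open>t i\<close> tensored with the generator. The factor \<open>t i\<close> also turns the
  \<open>tinv i\<close> in \<open>\<Delta> (y i)\<close> into 1.\<close>

lemma comult_coideal_generator:
  assumes "coideal_vector S k v" and B: "cq_subalgebra B" "levi_quantum S \<subseteq> B"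
    and T: "tinv k * t i \<in> B" and gen: "y i * t i + v * t i \<in> B"
  shows "\<Delta> (y i * t i + v * t i) \<in> tensor_sub B"
proof -
  define D where "D = \<Delta> v - 1 \<otimes> v"
  have "D * (t i \<otimes> t i) \<in> tensor_sub B"
  proof (rule tensor_sub_mult_right)
    show "D \<in> tensor_sub (levi_coset S k)"
      using assms(1) by (simp add: coideal_vector_def D_def)
    show "b * t i \<in> B" if "b \<in> levi_coset S k" for b
      using that B T by (auto simp: levi_coset_def cq_subalgebra_def mult.assoc)
  qed
  moreover have "(y i * t i) \<otimes> 1 \<in> tensor_sub B" "t i \<otimes> (y i * t i + v * t i) \<in> tensor_sub B"
    using B gen by (auto intro: tensor_sub_tens simp: cq_subalgebra_def)
  moreover have "\<Delta> v = D + 1 \<otimes> v"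
    by (simp add: D_def)
  then have "\<Delta> (y i * t i + v * t i) =
      (y i * t i) \<otimes> 1 + t i \<otimes> (y i * t i + v * t i) + D * (t i \<otimes> t i)"
    by (simp add: cq_linear_add[OF comult_linear] comult_mult comult_y grouplike
        distrib_right tens_mult tinv_t tens_add_right)
  ultimately show ?thesis by (simp add: tensor_sub_add)
qed

end


section \<open>The action of the involution on the root lattice\<close>

context maximally_split_involution
begin

lemma weight_add: "weight \<alpha> (c + d) a = weight \<alpha> c a + weight \<alpha> d a"
  by (simp add: weight_def distrib_right sum.distrib)

lemma weight_uminus: "weight \<alpha> (- c) a = - weight \<alpha> c a"
  by (simp add: weight_def sum_negf)

lemma weight_simple_root: "weight \<alpha> (simple_root i) a = \<alpha> i a"
proof -
  have "weight \<alpha> (simple_root i) a = (\<Sum>j\<in>UNIV. if j = i then \<alpha> j a else 0)"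
    unfolding weight_def by (rule sum.cong) (auto simp: simple_root_def)
  then show ?thesis by simp
qed

lemma simple_roots_independent:
  "(\<And>a. a \<in> H \<Longrightarrow> (\<Sum>i\<in>UNIV. k i * \<alpha> i a) = 0) \<Longrightarrow> k i = 0"
  using base unfolding base_def by blast

text \<open>Gives uniqueness in the description defining \<open>Theta\<close>, and afterwards proves
  identities in the root lattice by evaluation on H.\<close>

lemma weight_inject:
  assumes "\<And>a. a \<in> H \<Longrightarrow> weight \<alpha> c a = weight \<alpha> d a"
  shows "c = d"
proof
  fix i
  have "of_int (c i) - of_int (d i) = (0 :: complex)"
    by (rule simple_roots_independent[of "\<lambda>i. of_int (c i) - of_int (d i)"])
      (use assms in \<open>simp add: weight_def left_diff_distrib sum_subtractf\<close>)
  then show "c i = d i" by simp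
qed

lemma theta_in_H: "a \<in> H \<Longrightarrow> \<theta> a \<in> H"
  using theta_H by blast

text \<open>\<open>\<theta>(e\<^sub>i)\<close> is a root vector for the functional \<open>\<alpha>\<^sub>i \<circ> \<theta>\<close>, which is therefore a root.\<close>

lemma theta_simple_root_exists: "\<exists>c. \<forall>a\<in>H. \<alpha> i (\<theta> a) = weight \<alpha> c a"
proof -
  let ?l = "\<lambda>a. \<alpha> i (\<theta> a)"
  have root: "simple_root i \<in> roots"
    using base by (simp add: base_def)
  \<comment> \<open>An independent family does not contain 0, hence the root vector
    \<open>e i\<close> is nonzero.\<close>
  then have e: "e i \<in> root_space H (weight \<alpha> (simple_root i))" "e i \<noteq> 0"
    using chevalley_basis dependent_zero[of "E ` roots \<union> range h"]
    unfolding chevalley_basis_def e_def by (auto simp: image_iff)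
  have "\<theta> (e i) \<in> root_space H ?l"
    unfolding root_space_def
  proof (intro CollectI ballI)
    fix a assume "a \<in> H"
    then have "br (\<theta> a) (e i) = scale (\<alpha> i (\<theta> a)) (e i)"
      using e(1) theta_in_H by (auto simp: root_space_def weight_simple_root)
    then have "\<theta> (br (\<theta> a) (e i)) = scale (\<alpha> i (\<theta> a)) (\<theta> (e i))"
      by (simp add: theta_scale)
    then show "br a (\<theta> (e i)) = scale (\<alpha> i (\<theta> a)) (\<theta> (e i))"
      by (simp add: theta_br theta_theta)
  qed
  moreover have "\<theta> (e i) \<noteq> 0"
    using e(2) theta_theta[of "e i"] theta_scale[of 0 0] by auto
  \<comment> \<open>\<open>base\<close> speaks only of functionals that are nonzero on H. If
    \<alpha>_i \<circ> \<theta> vanished there, so would \<alpha>_i, because \<theta> is an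
    involution preserving H; but \<alpha>_i is not the zero weight.\<close>
  moreover have "\<exists>a\<in>H. ?l a \<noteq> 0"
  proof (rule ccontr)
    assume "\<not> (\<exists>a\<in>H. ?l a \<noteq> 0)"
    then have "\<alpha> i a = 0" if "a \<in> H" for a
      using that theta_in_H[OF that] theta_theta[of a] by metis
    then have "simple_root i = 0"
      by (intro weight_inject) (simp add: weight_simple_root, simp add: weight_def)
    then have "simple_root i i = 0" by simp
    then show False by (simp add: simple_root_def)
  qed
  moreover have "(\<exists>a\<in>H. l a \<noteq> 0) \<and> root_space H l \<noteq> {0} \<Longrightarrow> \<exists>c. \<forall>a\<in>H. l a = weight \<alpha> c a" for l
    using base unfolding base_def by metis
  ultimately show ?thesis
    by (metis singletonD)
qed

text \<open>Turns the definite description into a usable equation. The witness d extends the integer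
  coordinates r i of the functionals \<alpha>_i \<circ> \<theta> linearly to c.\<close>

lemma weight_Theta:
  assumes "a \<in> H"
  shows "weight \<alpha> (Theta H \<alpha> \<theta> c) a = weight \<alpha> c (\<theta> a)"
proof -
  obtain r where r: "\<And>i a. a \<in> H \<Longrightarrow> \<alpha> i (\<theta> a) = weight \<alpha> (r i) a"
    using theta_simple_root_exists by metis
  define d where "d = (\<lambda>j. \<Sum>i\<in>UNIV. c i * r i j)"
  have "weight \<alpha> d a = weight \<alpha> c (\<theta> a)" if "a \<in> H" for a
  proof -
    have "weight \<alpha> d a = (\<Sum>j\<in>UNIV. \<Sum>i\<in>UNIV. of_int (c i) * (of_int (r i j) * \<alpha> j a))"
      by (simp add: weight_def d_def sum_distrib_right mult.assoc)
    also have "\<dots> = (\<Sum>i\<in>UNIV. of_int (c i) * weight \<alpha> (r i) a)"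
      by (subst sum.swap) (simp add: weight_def sum_distrib_left)
    finally show ?thesis
      using that by (simp add: r weight_def[of \<alpha> c])
  qed
  then have d: "\<forall>a\<in>H. weight \<alpha> d a = weight \<alpha> c (\<theta> a)"
    by blast
  have "\<forall>a\<in>H. weight \<alpha> (Theta H \<alpha> \<theta> c) a = weight \<alpha> c (\<theta> a)"
    unfolding Theta_def
  proof (rule theI[of _ d])
    fix d' assume "\<forall>a\<in>H. weight \<alpha> d' a = weight \<alpha> c (\<theta> a)"
    then show "d' = d"
      using d by (intro weight_inject) simp
  qed (rule d)
  then show ?thesis using assms by blast
qed

lemma Theta_add: "Theta H \<alpha> \<theta> (c + d) = Theta H \<alpha> \<theta> c + Theta H \<alpha> \<theta> d"
  by (rule weight_inject) (simp add: weight_Theta weight_add)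

lemma Theta_uminus: "Theta H \<alpha> \<theta> (- c) = - Theta H \<alpha> \<theta> c"
  by (rule weight_inject) (simp add: weight_Theta weight_uminus)

lemma Theta_Theta: "Theta H \<alpha> \<theta> (Theta H \<alpha> \<theta> c) = c"
  by (rule weight_inject) (simp add: weight_Theta theta_in_H theta_theta)

lemma Theta_Q_plus_black:
  assumes "c \<in> Q_plus black"
  shows "Theta H \<alpha> \<theta> c = c"
proof (rule weight_inject)
  fix a assume a: "a \<in> H"
  have "\<alpha> i (\<theta> a) = \<alpha> i a" if "i \<in> black" for i
    using weight_Theta[OF a, of "simple_root i"] that
    by (simp add: pi_Theta_def weight_simple_root)
  then have "of_int (c i) * \<alpha> i (\<theta> a) = of_int (c i) * \<alpha> i a" for i
    using assms by (cases "i \<in> black") (auto simp: Q_plus_def)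
  then have "weight \<alpha> c (\<theta> a) = weight \<alpha> c a"
    unfolding weight_def by (intro sum.cong refl)
  then show "weight \<alpha> (Theta H \<alpha> \<theta> c) a = weight \<alpha> c a"
    by (simp add: weight_Theta a)
qed

end

context symmetric_pair_data
begin

text \<open>Let c = \<Theta>(-\<alpha>_i) - \<alpha>_p(i), which \<Theta> fixes. Then
  \<Theta>(\<alpha>_i) = -c - \<alpha>_p(i), and applying \<Theta> once more gives
  \<Theta>(\<alpha>_p(i)) = -\<alpha>_i - c; the two copies of c cancel in the difference.\<close>

lemma Theta_simple_root_diff:
  assumes "i \<notin> black"
  shows "Theta H \<alpha> \<theta> (simple_root i - simple_root (p i)) = simple_root i - simple_root (p i)"
proof -
  define c where "c = Theta H \<alpha> \<theta> (- simple_root i) - simple_root (p i)"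
  have c: "Theta H \<alpha> \<theta> c = c"
    unfolding c_def by (rule Theta_Q_plus_black[OF p_Theta[OF assms]])
  have "- simple_root i = Theta H \<alpha> \<theta> (c + simple_root (p i))"
    by (simp add: c_def Theta_Theta)
  then have "- simple_root i = c + Theta H \<alpha> \<theta> (simple_root (p i))"
    by (simp add: Theta_add c)
  then have "Theta H \<alpha> \<theta> (simple_root (p i)) = - simple_root i - c"
    by (simp add: algebra_simps)
  moreover have "Theta H \<alpha> \<theta> (simple_root i) = - c - simple_root (p i)"
    by (simp add: c_def Theta_uminus)
  ultimately show ?thesis
    using Theta_add[of "simple_root i" "- simple_root (p i)"] by (simp add: Theta_uminus)
qed

end

context quantum_symmetric_pair
begin

section \<open>The generators of B and the coideal property\<close>

abbreviation B :: "'u set"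
  where "B \<equiv> coideal_B black x y t tinv (T_Theta H \<alpha> \<theta> \<tau>) \<theta>t"

lemma theta_tilde_coideal_vector:
  assumes "i \<notin> black"
  shows "\<exists>k. coideal_vector black k (\<theta>t (y i)) \<and> tinv k * t i \<in> T_Theta H \<alpha> \<theta> \<tau>"
proof -
  have T: "tinv k * t j \<in> T_Theta H \<alpha> \<theta> \<tau>"
    if "Theta H \<alpha> \<theta> (simple_root j - simple_root k) = simple_root j - simple_root k" for j k
  proof -
    have "\<tau> (simple_root j - simple_root k) = tinv k * t j"
      using tau_add[of "- simple_root k" "simple_root j"] by (simp add: tau_uminus tau_simple)
    then show ?thesis using that unfolding T_Theta_def by (metis (mono_tags, lifting) mem_Collect_eq)
  qed
  show ?thesis
  proof (cases "i \<in> pi_star")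
    case True
    then show ?thesis
      using T[OF Theta_simple_root_diff[OF assms]] coideal_vector_ad_r_word[OF word_black[OF True]]
      by (auto simp: theta_tilde_y)
  next
    case False
    \<comment> \<open>As i is outside \<open>pi_star\<close>, its preimage j under p lies inside: j
      = i would contradict \<open>pi_star_fixed\<close>, and otherwise \<open>pi_star_moved\<close>
      selects exactly one of j and i. The reversed word of j then describes
      \<open>\<theta>t (y i)\<close>.\<close>
    obtain j where j: "j \<notin> black" "i = p j"
      using p_bij assms by (auto simp: bij_betw_def)
    with False have "j \<in> pi_star"
      using pi_star_fixed[of j] pi_star_moved[of j] by auto
    then have "coideal_vector black j (\<theta>t (y i))"
      using coideal_vector_ad_r_word[of "rev (w j)" black j] word_black[of j]
      by (simp add: j(2) theta_tilde_y_p coideal_vector_scale)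
    \<comment> \<open>Here k = j, and the fixed difference of simple roots is the negative of the
      one supplied for j.\<close>
    moreover have "Theta H \<alpha> \<theta> (simple_root i - simple_root j) = simple_root i - simple_root j"
      using Theta_simple_root_diff[OF j(1)] Theta_uminus[of "simple_root j - simple_root i"]
      by (simp add: j(2))
    ultimately show ?thesis using T by blast
  qed
qed

lemma left_coideal_B: "left_coideal_subalgebra \<Delta> B"
  unfolding coideal_B_def
proof (rule left_coideal_subalgebra_hull[OF comult_hom], fold coideal_B_def)
  have B: "cq_subalgebra B"
    unfolding coideal_B_def by (rule cq_subalgebra_hull)
  have sub: "levi_quantum black \<subseteq> B" "T_Theta H \<alpha> \<theta> \<tau> \<subseteq> B"
    "i \<notin> black \<Longrightarrow> y i * t i + \<theta>t (y i) * t i \<in> B" for i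
    unfolding coideal_B_def by (auto intro: hull_inc)
  fix s
  assume "s \<in> levi_quantum black \<union> T_Theta H \<alpha> \<theta> \<tau> \<union> {y i * t i + \<theta>t (y i) * t i |i. i \<notin> black}"
  then consider "s \<in> levi_quantum black" | "s \<in> T_Theta H \<alpha> \<theta> \<tau>"
    | i where "i \<notin> black" "s = y i * t i + \<theta>t (y i) * t i"
    by blast
  then show "\<Delta> s \<in> tensor_sub B"
  proof cases
    case 1
    \<comment> \<open>The inclusion of U \<otimes> M in U \<otimes> B is
      \<open>tensor_sub_linear\<close> applied to the identity map.\<close>
    show ?thesis
      by (rule tensor_sub_linear[OF cq_linear_id _ comult_levi[OF 1]])
        (use sub(1) in \<open>auto intro: tensor_sub_tens\<close>)
  next
    case 2
    then have "\<Delta> s = s \<otimes> s"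
      by (auto simp: T_Theta_def comult_T tau_torus)
    then show ?thesis
      using 2 sub(2) by (auto intro: tensor_sub_tens)
  next
    case 3
    obtain k where "coideal_vector black k (\<theta>t (y i))" "tinv k * t i \<in> T_Theta H \<alpha> \<theta> \<tau>"
      using theta_tilde_coideal_vector[OF 3(1)] by blast
    then show ?thesis
      unfolding 3(2) using B sub 3(1) by (intro comult_coideal_generator) auto
  qed
qed

end

theorem theorem7p2:
  fixes scale :: "complex \<Rightarrow> 'g::ab_group_add \<Rightarrow> 'g"
    and br :: "'g \<Rightarrow> 'g \<Rightarrow> 'g"
    and H :: "'g set"
    and \<alpha> :: "'i::finite \<Rightarrow> 'g \<Rightarrow> complex"
    and E :: "('i \<Rightarrow> int) \<Rightarrow> 'g"
    and ip :: "'i \<Rightarrow> 'i \<Rightarrow> int"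
    and \<theta> :: "'g \<Rightarrow> 'g"
    and p :: "'i \<Rightarrow> 'i"
    and pi_star :: "'i set"
    and w :: "'i \<Rightarrow> ('i \<times> nat) list"
    and x y t tinv :: "'i \<Rightarrow> 'u::cq_algebra"
    and \<tau> :: "('i \<Rightarrow> int) \<Rightarrow> 'u"
    and \<Delta> :: "'u \<Rightarrow> ('u, 'u) tensor"
    and \<epsilon> :: "'u \<Rightarrow> Cq"
    and \<sigma> :: "'u \<Rightarrow> 'u"
    and \<theta>t :: "'u \<Rightarrow> 'u"
  assumes "quantum_symmetric_pair scale br H \<alpha> E ip \<theta> p pi_star w x y t tinv \<tau> \<Delta> \<epsilon> \<sigma> \<theta>t"
  shows "left_coideal_subalgebra \<Delta>
    (coideal_B (pi_Theta H \<alpha> \<theta>) x y t tinv (T_Theta H \<alpha> \<theta> \<tau>) \<theta>t)"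
  using assms by (rule quantum_symmetric_pair.left_coideal_B)

end
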